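(* Let $m\ge2$ and let $A_1,\dots,A_m$ be real symmetric $N\times N$ matrices with $A_iA_j+A_jA_i=2\delta_{ij}I$. For $x\in\mathbb R^N$ set $P_i(x)=\langle A_ix,x\rangle$, $P=(P_1,\dots,P_m):\mathbb R^N\to\mathbb R^m$, $R=|x|^2$, $Q=|P|^2$. If $\mathcal A\subset\mathbb R[y_1,\dots,y_m]$ is a graded Laplacian algebra, then $\mathbb R[R,P^*\mathcal A]$ is a Laplacian algebra on $\mathbb R^N$. Moreover, $P$ is onto, $Q\le R^2$, and $P^{-1}(0)\setminus\{0\}$, when nonempty, is a smooth submanifold of codimension $m$. The map $P$ is a homogeneous quadratic harmonic morphism whose squared dilation is $\lambda^2=4R$ (that is, $\Delta P_i=0$ and $\langle\nabla P_i,\nabla P_j\rangle=4R\,\delta_{ij}$), and it satisfies $$dP(\nabla\lambda^2)=\eta P\ \text{ with }\eta=16,\qquad \frac{|P(x)|^2\,\eta}{2\lambda(x)^4}\le\kappa=\frac12\quad(x\ne0).$$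
   Context: A Laplacian algebra is a graded subalgebra of a real polynomial ring (containing the homogeneous components of each of its elements) that contains the squared Euclidean norm of the variables and is closed under the Euclidean Laplacian. $P^*\mathcal A=\{u\circ P:u\in\mathcal A\}$, and $\mathbb R[R,P^*\mathcal A]$ is the subalgebra of $\mathbb R[x_1,\dots,x_N]$ generated by $R$ and $P^*\mathcal A$. *)

theory Defs
  imports "HOL-Analysis.Analysis"
begin

section \<open>Differential operators on coordinate space\<close>

definition partial :: "'n \<Rightarrow> (real^'n \<Rightarrow> real) \<Rightarrow> real^'n \<Rightarrow> real"
  where "partial i f x = frechet_derivative f (at x) (axis i 1)"

definition grad :: "(real^'n \<Rightarrow> real) \<Rightarrow> real^'n \<Rightarrow> real^'n"
  where "grad f x = (\<chi> i. partial i f x)"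

definition laplacian :: "(real^'n \<Rightarrow> real) \<Rightarrow> real^'n \<Rightarrow> real"
  where "laplacian f x = (\<Sum>i\<in>UNIV. partial i (partial i f) x)"

text \<open>
  The predicates \<open>Ck_on\<close> and \<open>smooth_on\<close> are meant for open subsets of finite-dimensional spaces,
  where continuity of all iterated directional derivatives up to order \<open>k\<close> is the same as
  \<open>k\<close>-fold continuous differentiability.
\<close>

fun Ck_on :: "nat \<Rightarrow> ('a::real_normed_vector \<Rightarrow> 'b::real_normed_vector) \<Rightarrow> 'a set \<Rightarrow> bool"
  where
    "Ck_on 0 f S \<longleftrightarrow> continuous_on S f"
  | "Ck_on (Suc k) f S \<longleftrightarrow>
       (\<forall>x\<in>S. f differentiable (at x)) \<and>
       (\<forall>v. Ck_on k (\<lambda>x. frechet_derivative f (at x) v) S)"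

definition smooth_on :: "('a::real_normed_vector \<Rightarrow> 'b::real_normed_vector) \<Rightarrow> 'a set \<Rightarrow> bool"
  where "smooth_on f S \<longleftrightarrow> (\<forall>k. Ck_on k f S)"


section \<open>Laplacian algebras\<close>

text \<open>
  Since the field of real numbers is infinite, the polynomial ring in variables indexed by \<open>'n\<close>
  is identified with the ring of polynomial functions on \<open>real^'n\<close>.
\<close>

definition subalgebra :: "(real^'n \<Rightarrow> real) set \<Rightarrow> bool"
  where "subalgebra S \<longleftrightarrow>
    S \<subseteq> {f. real_polynomial_function f} \<and>
    (\<forall>c. (\<lambda>x. c) \<in> S) \<and>
    (\<forall>f\<in>S. \<forall>g\<in>S. (\<lambda>x. f x + g x) \<in> S \<and> (\<lambda>x. f x * g x) \<in> S)"

definition homogeneous_poly :: "nat \<Rightarrow> (real^'n \<Rightarrow> real) \<Rightarrow> bool"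
  where "homogeneous_poly d f \<longleftrightarrow>
    (\<exists>c. f = (\<lambda>x. \<Sum>\<alpha> | (\<Sum>i\<in>UNIV. \<alpha> i) = d. c \<alpha> * (\<Prod>i\<in>UNIV. (x $ i) ^ \<alpha> i)))"

text \<open>
  The decomposition of a polynomial function into homogeneous components is unique, so the
  functions \<open>g d\<close> below are the homogeneous components of \<open>f\<close>.
\<close>

definition graded :: "(real^'n \<Rightarrow> real) set \<Rightarrow> bool"
  where "graded S \<longleftrightarrow>
    (\<forall>f\<in>S. \<exists>n g. (\<forall>d\<le>n. homogeneous_poly d (g d) \<and> g d \<in> S) \<and>
                  f = (\<lambda>x. \<Sum>d\<le>n. g d x))"

definition laplacian_algebra :: "(real^'n \<Rightarrow> real) set \<Rightarrow> bool"
  where "laplacian_algebra S \<longleftrightarrow>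
    subalgebra S \<and> graded S \<and> (\<lambda>x. (norm x)\<^sup>2) \<in> S \<and> (\<forall>f\<in>S. laplacian f \<in> S)"

definition pullback :: "('a \<Rightarrow> 'b) \<Rightarrow> ('b \<Rightarrow> real) set \<Rightarrow> ('a \<Rightarrow> real) set"
  where "pullback P S = {u \<circ> P | u. u \<in> S}"

definition generated_algebra :: "(real^'n \<Rightarrow> real) set \<Rightarrow> (real^'n \<Rightarrow> real) set"
  where "generated_algebra G = subalgebra hull G"


section \<open>Submanifolds and harmonic morphisms\<close>

definition diffeomorphism_between :: "('a::real_normed_vector \<Rightarrow> 'a) \<Rightarrow> 'a set \<Rightarrow> 'a set \<Rightarrow> bool"
  where "diffeomorphism_between \<phi> U V \<longleftrightarrow>
    open U \<and> open V \<and> bij_betw \<phi> U V \<and> smooth_on \<phi> U \<and> smooth_on (inv_into U \<phi>) V"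

text \<open>Embedded submanifolds, by slice charts.\<close>

definition smooth_submanifold_codim :: "nat \<Rightarrow> 'a::euclidean_space set \<Rightarrow> bool"
  where "smooth_submanifold_codim k M \<longleftrightarrow>
    (\<forall>p\<in>M. \<exists>U V \<phi> L. p \<in> U \<and> diffeomorphism_between \<phi> U V \<and>
       subspace L \<and> dim L + k = DIM('a) \<and> \<phi> ` (U \<inter> M) = V \<inter> L)"

definition harmonic_on :: "(real^'n \<Rightarrow> real) \<Rightarrow> (real^'n) set \<Rightarrow> bool"
  where "harmonic_on u V \<longleftrightarrow> Ck_on 2 u V \<and> (\<forall>y\<in>V. laplacian u y = 0)"

definition harmonic_morphism :: "(real^'n \<Rightarrow> real^'m) \<Rightarrow> bool"
  where "harmonic_morphism P \<longleftrightarrow>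
    smooth_on P UNIV \<and>
    (\<forall>V u. open V \<and> harmonic_on u V \<longrightarrow> harmonic_on (u \<circ> P) (P -` V))"

text \<open>
  The squared dilation is a property of the coordinate functions: their gradients are pairwise
  orthogonal and all of squared length \<open>\<lambda>\<^sup>2\<close>.
\<close>

definition has_squared_dilation :: "(real^'n \<Rightarrow> real^'m) \<Rightarrow> (real^'n \<Rightarrow> real) \<Rightarrow> bool"
  where "has_squared_dilation P lamsq \<longleftrightarrow>
    (\<forall>i j x. grad (\<lambda>x. P x $ i) x \<bullet> grad (\<lambda>x. P x $ j) x = (if i = j then lamsq x else 0))"

end

theory Submission
  imports Defs
begin

text \<open>
  Everything rests on one consequence of the Clifford relations: at every point \<open>x\<close> the vectors
  \<open>A i *v x\<close> are orthogonal and have length \<open>norm x\<close> (\<open>inner_A_A\<close>). They are half the gradients of the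
  components of \<open>P\<close>, so the squared dilation is \<open>4 * (norm x)\<^sup>2\<close>. The components of \<open>P x\<close> are the
  inner products of \<open>x\<close> with these vectors, so \<open>Q \<le> R\<^sup>2\<close> is Bessel's inequality (\<open>norm_quad_le\<close>).
  Since \<open>m \<ge> 2\<close>, each \<open>A i\<close> is conjugate to \<open>- A i\<close> and so has trace zero (\<open>trace_eq_0\<close>). This makes
  the components harmonic, and the chain rule for the Laplacian shows that \<open>P\<close> is a harmonic morphism
  (\<open>harmonic_morphism_dilation\<close>). It also makes unit combinations of the \<open>A i\<close> involutions of trace
  zero; a fixed vector of such an involution realizes equality in Bessel's inequality in the
  prescribed direction, and hence \<open>P\<close> is onto (\<open>surj_quad\<close>).

  For the algebra statement the product rule
  \<open>\<Delta>(f g) = f \<Delta>g + g \<Delta>f + 2 \<langle>\<nabla>f, \<nabla>g\<rangle>\<close> is used in two ways. On a Laplacian algebra it shows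
  that \<open>\<langle>\<nabla>u, \<nabla>v\<rangle>\<close> stays in the algebra. On an algebra given by generators it reduces closure
  under \<open>\<Delta>\<close> to the values of \<open>\<Delta>g\<close> and \<open>\<langle>\<nabla>g, \<nabla>h\<rangle>\<close> for generators \<open>g\<close> and \<open>h\<close>
  (\<open>laplacian_closed_generated\<close>). For the generators \<open>R\<close> and \<open>u \<circ> P\<close> these values are
  polynomials in \<open>R\<close> and pullbacks, by conformality, harmonicity and Euler's identity
  (\<open>laplacian_algebra_generated_pullback\<close>).

  Finally, \<open>P\<close> is a submersion at the nonzero points of its zero set, and a slice chart is given by a
  smooth inverse function theorem (\<open>smooth_inverse_function\<close>), which is derived from the \<open>C\<^sup>1\<close> version by
  Cramer's rule and a bootstrap.
\<close>


section \<open>Calculus of k-fold continuously differentiable functions\<close>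

lemma Ck_on_cong:
  assumes "open S" "Ck_on k f S" "\<And>x. x \<in> S \<Longrightarrow> f x = g x"
  shows "Ck_on k g S"
  using assms
proof (induction k arbitrary: f g)
  case 0
  then show ?case by (simp cong: continuous_on_cong)
next
  case (Suc k)
  have der: "(g has_derivative frechet_derivative f (at x)) (at x)" if "x \<in> S" for x
    using Suc.prems that has_derivative_transform_within_open[of f _ x UNIV S g]
    by (simp add: frechet_derivative_works)
  have "Ck_on k (\<lambda>x. frechet_derivative g (at x) v) S" for v
    by (rule Suc.IH[of "\<lambda>x. frechet_derivative f (at x) v"])
      (use Suc.prems frechet_derivative_at[OF der] in auto)
  then show ?case
    using der by (auto simp: differentiable_def)
qed

text \<open>
  With \<open>frechet_derivative\<close> given by choice, its value must be identified at every point of the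
  set. This rule does so once, so that each closure property below only has to exhibit a derivative
  and show that its directional derivatives are again of class \<open>C\<^sup>k\<close>.
\<close>

lemma Ck_on_SucI:
  assumes "open S" "\<And>x. x \<in> S \<Longrightarrow> (f has_derivative D x) (at x)"
    and "\<And>v. Ck_on k (\<lambda>x. D x v) S"
  shows "Ck_on (Suc k) f S"
proof -
  have "Ck_on k (\<lambda>x. frechet_derivative f (at x) v) S" for v
    by (rule Ck_on_cong[OF \<open>open S\<close> assms(3)[of v]])
      (use frechet_derivative_at[OF assms(2)] in auto)
  then show ?thesis
    using assms(2) by (auto simp: differentiable_def)
qed

lemma Ck_on_SucD:
  assumes "Ck_on (Suc k) f S"
  shows "x \<in> S \<Longrightarrow> (f has_derivative frechet_derivative f (at x)) (at x)"
    and "Ck_on k (\<lambda>x. frechet_derivative f (at x) v) S"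
  using assms by (auto simp: frechet_derivative_works)

lemma Ck_on_Suc_imp: "Ck_on (Suc k) f S \<Longrightarrow> Ck_on k f S"
proof (induction k arbitrary: f)
  case 0
  then show ?case
    by (auto intro!: continuous_at_imp_continuous_on differentiable_imp_continuous_within)
next
  case (Suc k)
  then show ?case by (metis Ck_on.simps(2))
qed

lemma Ck_on_imp_continuous_on: "Ck_on k f S \<Longrightarrow> continuous_on S f"
  by (induction k) (use Ck_on.simps(1) Ck_on_Suc_imp in blast)+

lemma Ck_on_subset: "Ck_on k f S \<Longrightarrow> T \<subseteq> S \<Longrightarrow> Ck_on k f T"
  by (induction k arbitrary: f) (auto intro: continuous_on_subset)

lemma Ck_on_const: "open S \<Longrightarrow> Ck_on k (\<lambda>x. c) S"
  by (induction k arbitrary: c) (auto intro!: Ck_on_SucI[where D="\<lambda>x h. 0"] simp del: Ck_on.simps(2))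

lemma Ck_on_bounded_linear:
  assumes "open S" "bounded_linear f"
  shows "Ck_on k f S"
proof (cases k)
  case 0
  then show ?thesis using assms by (simp add: linear_continuous_on)
next
  case (Suc l)
  show ?thesis unfolding Suc
    by (rule Ck_on_SucI[where D="\<lambda>x. f"])
      (use assms bounded_linear_imp_has_derivative Ck_on_const in auto)
qed

lemma Ck_on_add:
  assumes "open S" "Ck_on k f S" "Ck_on k g S"
  shows "Ck_on k (\<lambda>x. f x + g x) S"
  using assms(2,3)
proof (induction k arbitrary: f g)
  case 0
  then show ?case by (simp add: continuous_on_add)
next
  case (Suc k)
  show ?case
    by (rule Ck_on_SucI[OF \<open>open S\<close> has_derivative_add[OF Ck_on_SucD(1)[OF Suc.prems(1)]
          Ck_on_SucD(1)[OF Suc.prems(2)]]])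
      (auto intro!: Suc.IH Ck_on_SucD(2)[OF Suc.prems(1)] Ck_on_SucD(2)[OF Suc.prems(2)])
qed

lemma Ck_on_sum:
  assumes "open S" "\<And>i. i \<in> I \<Longrightarrow> Ck_on k (f i) S"
  shows "Ck_on k (\<lambda>x. \<Sum>i\<in>I. f i x) S"
  using assms(2)
  by (induction I rule: infinite_finite_induct) (auto simp: \<open>open S\<close> Ck_on_const Ck_on_add)

lemma Ck_on_scaleR:
  assumes "open S" "Ck_on k f S" "Ck_on k g S"
  shows "Ck_on k (\<lambda>x. f x *\<^sub>R g x) S"
  using assms(2,3)
proof (induction k arbitrary: f g)
  case 0
  then show ?case by (simp add: continuous_on_scaleR)
next
  case (Suc k)
  show ?case
    by (rule Ck_on_SucI[OF \<open>open S\<close> has_derivative_scaleR[OF Ck_on_SucD(1)[OF Suc.prems(1)]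
          Ck_on_SucD(1)[OF Suc.prems(2)]]])
      (auto intro!: Ck_on_add \<open>open S\<close> Suc.IH Ck_on_SucD(2)[OF Suc.prems(1)]
        Ck_on_SucD(2)[OF Suc.prems(2)] Ck_on_Suc_imp[OF Suc.prems(1)] Ck_on_Suc_imp[OF Suc.prems(2)])
qed

lemma Ck_on_mult:
  fixes f g :: "'a::real_normed_vector \<Rightarrow> real"
  shows "open S \<Longrightarrow> Ck_on k f S \<Longrightarrow> Ck_on k g S \<Longrightarrow> Ck_on k (\<lambda>x. f x * g x) S"
  using Ck_on_scaleR[of S k f g] by simp

lemma Ck_on_prod:
  fixes f :: "'i \<Rightarrow> 'a::real_normed_vector \<Rightarrow> real"
  assumes "open S" "\<And>i. i \<in> I \<Longrightarrow> Ck_on k (f i) S"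
  shows "Ck_on k (\<lambda>x. \<Prod>i\<in>I. f i x) S"
  using assms(2)
  by (induction I rule: infinite_finite_induct) (auto simp: \<open>open S\<close> Ck_on_const Ck_on_mult)

lemma Ck_on_inverse:
  fixes f :: "'a::real_normed_vector \<Rightarrow> real"
  assumes "open S" "Ck_on k f S" "\<And>x. x \<in> S \<Longrightarrow> f x \<noteq> 0"
  shows "Ck_on k (\<lambda>x. inverse (f x)) S"
  using assms(2)
proof (induction k)
  case 0
  then show ?case using assms(3) by (simp add: continuous_on_inverse)
next
  case (Suc k)
  have I: "Ck_on k (\<lambda>x. inverse (f x)) S"
    by (rule Suc.IH[OF Ck_on_Suc_imp[OF Suc.prems]])
  have 1: "((\<lambda>x. inverse (f x)) has_derivative
      (\<lambda>h. (-1) * (inverse (f x) * frechet_derivative f (at x) h * inverse (f x)))) (at x)" if "x \<in> S" for x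
    using Deriv.has_derivative_inverse[OF assms(3)[OF that] Ck_on_SucD(1)[OF Suc.prems that]] by simp
  show ?case
    by (rule Ck_on_SucI[OF \<open>open S\<close> 1])
      (assumption | intro Ck_on_mult Ck_on_const \<open>open S\<close> I Ck_on_SucD(2)[OF Suc.prems])+
qed

lemma Ck_on_bounded_linear_compose:
  assumes "open S" "bounded_linear L" "Ck_on k f S"
  shows "Ck_on k (\<lambda>x. L (f x)) S"
  using assms(3)
proof (induction k arbitrary: f)
  case 0
  then show ?case by (simp add: assms(2) bounded_linear.continuous_on)
next
  case (Suc k)
  show ?case
    by (rule Ck_on_SucI[OF \<open>open S\<close> bounded_linear.has_derivative[OF assms(2) Ck_on_SucD(1)[OF Suc.prems]]])
      (auto intro!: Suc.IH Ck_on_SucD(2)[OF Suc.prems])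
qed

lemma Ck_on_vec_lambda:
  fixes f :: "'a::real_normed_vector \<Rightarrow> real^'n"
  assumes "open S" "\<And>i. Ck_on k (\<lambda>x. f x $ i) S"
  shows "Ck_on k f S"
proof -
  have "Ck_on k (\<lambda>x. \<Sum>i\<in>UNIV. f x $ i *\<^sub>R (axis i 1 :: real^'n)) S"
    by (intro Ck_on_sum Ck_on_scaleR Ck_on_const assms)
  then show ?thesis
    by (rule Ck_on_cong[OF \<open>open S\<close>])
      (simp add: vec_eq_iff axis_def if_distrib cong: if_cong)
qed

text \<open>
  Expanding the inner derivative in the basis turns the chain rule into a finite sum of products of
  directional derivatives, which is the form the induction hypothesis applies to.
\<close>

lemma Ck_on_compose:
  fixes f :: "'a::real_normed_vector \<Rightarrow> 'b::euclidean_space"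
    and u :: "'b \<Rightarrow> 'c::real_normed_vector"
  assumes "open S" "Ck_on k f S" "Ck_on k u T" "f ` S \<subseteq> T"
  shows "Ck_on k (\<lambda>x. u (f x)) S"
  using assms(2,3)
proof (induction k arbitrary: u)
  case 0
  then show ?case using assms(4) continuous_on_compose2[of T u S f] by simp
next
  case (Suc k)
  let ?D = "\<lambda>x v. \<Sum>b\<in>Basis. (frechet_derivative f (at x) v \<bullet> b) *\<^sub>R frechet_derivative u (at (f x)) b"
  have 1: "((\<lambda>x. u (f x)) has_derivative ?D x) (at x)" if "x \<in> S" for x
  proof -
    have fx: "f x \<in> T" using that assms(4) by auto
    note uf = Ck_on_SucD(1)[OF Suc.prems(2) fx]
    have expand: "frechet_derivative u (at (f x)) w = (\<Sum>b\<in>Basis. (w \<bullet> b) *\<^sub>R frechet_derivative u (at (f x)) b)" for w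
    proof -
      have "frechet_derivative u (at (f x)) (\<Sum>b\<in>Basis. (w \<bullet> b) *\<^sub>R b) =
        (\<Sum>b\<in>Basis. (w \<bullet> b) *\<^sub>R frechet_derivative u (at (f x)) b)"
        using has_derivative_linear[OF uf] by (simp add: linear_sum linear_cmul)
      then show ?thesis by (simp add: euclidean_representation)
    qed
    have "((\<lambda>x. u (f x)) has_derivative
        (\<lambda>v. frechet_derivative u (at (f x)) (frechet_derivative f (at x) v))) (at x)"
      by (rule has_derivative_compose[OF Ck_on_SucD(1)[OF Suc.prems(1) that] uf])
    then show ?thesis by (subst (asm) expand)
  qed
  have "Ck_on k (\<lambda>x. ?D x v) S" for v
  proof (intro Ck_on_sum Ck_on_scaleR \<open>open S\<close>)
    fix b :: 'b
    show "Ck_on k (\<lambda>x. frechet_derivative f (at x) v \<bullet> b) S"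
      by (rule Ck_on_bounded_linear_compose[OF \<open>open S\<close> bounded_linear_inner_left
            Ck_on_SucD(2)[OF Suc.prems(1)]])
    show "Ck_on k (\<lambda>x. frechet_derivative u (at (f x)) b) S"
      by (rule Suc.IH[OF Ck_on_Suc_imp[OF Suc.prems(1)] Ck_on_SucD(2)[OF Suc.prems(2)]])
  qed
  with 1 show ?case
    by (intro Ck_on_SucI[OF \<open>open S\<close>])
qed

lemma real_polynomial_function_Ck_on:
  "real_polynomial_function f \<Longrightarrow> open S \<Longrightarrow> Ck_on k f S"
  by (induction rule: real_polynomial_function.induct)
    (auto intro: Ck_on_bounded_linear Ck_on_const Ck_on_add Ck_on_mult)


section \<open>A smooth inverse function theorem\<close>

lemma Ck_on_det:
  fixes M :: "'a::real_normed_vector \<Rightarrow> real^'n^'n"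
  assumes "open S" "\<And>i j. Ck_on k (\<lambda>x. M x $ i $ j) S"
  shows "Ck_on k (\<lambda>x. det (M x)) S"
  unfolding det_def by (intro Ck_on_sum Ck_on_mult Ck_on_const Ck_on_prod assms)

text \<open>
  By Cramer's rule the solution of a linear system is rational in its coefficients, so it depends on
  a parameter as smoothly as they do. This replaces differentiating the inversion of operators.
\<close>

lemma Ck_on_solve_linear_system:
  fixes M :: "'a::real_normed_vector \<Rightarrow> real^'n^'n" and w :: "'a \<Rightarrow> real^'n"
  assumes "open S" "\<And>i j. Ck_on k (\<lambda>x. M x $ i $ j) S"
    and "\<And>x. x \<in> S \<Longrightarrow> det (M x) \<noteq> 0"
    and "\<And>x. x \<in> S \<Longrightarrow> M x *v w x = b"
  shows "Ck_on k w S"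
proof -
  let ?C = "\<lambda>k x. \<chi> i j. if j = k then b $ i else M x $ i $ j"
  have C: "Ck_on k (\<lambda>x. det (?C l x)) S" for l
  proof (rule Ck_on_det[OF \<open>open S\<close>])
    fix i j show "Ck_on k (\<lambda>x. ?C l x $ i $ j) S"
      by (cases "j = l") (auto intro: Ck_on_const assms)
  qed
  have "Ck_on k (\<lambda>x. \<chi> l. det (?C l x) * inverse (det (M x))) S"
    by (rule Ck_on_vec_lambda[OF \<open>open S\<close>])
      (simp, intro Ck_on_mult Ck_on_inverse Ck_on_det C assms)
  then show ?thesis
  proof (rule Ck_on_cong[OF \<open>open S\<close>])
    fix x assume x: "x \<in> S"
    show "(\<chi> l. det (?C l x) * inverse (det (M x))) = w x"
      using cramer[OF assms(3)[OF x], of "w x" b] assms(4)[OF x] by (simp add: divide_inverse)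
  qed
qed


text \<open>
  The \<open>C\<^sup>1\<close> inverse function theorem gives a differentiable local inverse \<open>g\<close> whose derivative is
  the inverse of the derivative of \<open>\<phi>\<close> at \<open>g y\<close>. That inverse operator depends smoothly on its base
  point, so if \<open>g\<close> is \<open>C\<^sup>k\<close> then its derivative is \<open>C\<^sup>k\<close> by composition, and \<open>g\<close> is \<open>C\<^sup>k\<^sup>+\<^sup>1\<close>.
\<close>

lemma smooth_inverse_function:
  fixes \<phi> :: "real^'n \<Rightarrow> real^'n"
  assumes "open U" "smooth_on \<phi> U" "p \<in> U" "bij (frechet_derivative \<phi> (at p))"
  obtains U' V where "U' \<subseteq> U" "p \<in> U'" "diffeomorphism_between \<phi> U' V"
proof -
  define D where "D x = frechet_derivative \<phi> (at x)" for x
  have Ck: "Ck_on k \<phi> U" for k using assms(2) by (simp add: smooth_on_def)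
  have der: "(\<phi> has_derivative D x) (at x)" if "x \<in> U" for x
    using Ck_on_SucD(1)[OF Ck that] by (simp add: D_def)
  have DCk: "Ck_on k (\<lambda>x. D x v) U" for k v
    using Ck_on_SucD(2)[OF Ck] by (simp add: D_def)
  have ap: "blinfun_apply (Blinfun (D x)) = D x" if "x \<in> U" for x
    using has_derivative_bounded_linear[OF der[OF that]] by (simp add: bounded_linear_Blinfun_apply)
  have cont: "continuous_on U (\<lambda>x. Blinfun (D x))"
    by (rule continuous_on_blinfun_componentwise)
      (use Ck_on_imp_continuous_on[OF DCk] ap in \<open>simp cong: continuous_on_cong\<close>)
  have lin: "linear (D p)" using der[OF assms(3)] has_derivative_linear by blast
  obtain h where h: "linear h" "h \<circ> D p = id"
    using linear_injective_left_inverse[OF lin] assms(4) by (auto simp: D_def bij_is_inj)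
  have "Blinfun h o\<^sub>L Blinfun (D p) = id_blinfun"
    using h(2) by (intro blinfun_eqI)
      (simp add: ap[OF assms(3)] bounded_linear_Blinfun_apply linear_conv_bounded_linear[THEN iffD1, OF h(1)] fun_eq_iff)
  from inverse_function_theorem[OF \<open>open U\<close> _ cont assms(3) this, of \<phi>] der ap
  obtain U' V g g' where U': "open U'" "U' \<subseteq> U" "p \<in> U'" "open V"
    and hom: "homeomorphism U' V \<phi> g"
    and g': "\<And>y. y \<in> V \<Longrightarrow> (g has_derivative (g' y)) (at y)"
    and inv0: "\<And>y. y \<in> V \<Longrightarrow> g' y = inv (blinfun_apply (Blinfun (D (g y))))"
    and bij0: "\<And>y. y \<in> V \<Longrightarrow> bij (blinfun_apply (Blinfun (D (g y))))"
    by (metis (no_types, lifting))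
  have gU: "g y \<in> U'" if "y \<in> V" for y
    using hom that by (auto simp: homeomorphism_def)
  have bijD: "bij (D x)" if "x \<in> U'" for x
    using bij0[of "\<phi> x"] hom that ap[of x] U'(2) by (force simp: homeomorphism_def)
  have inv: "g' y = inv (D (g y))" if "y \<in> V" for y
    using inv0[OF that] ap gU[OF that] U'(2) by auto
  have linD: "linear (D x)" if "x \<in> U'" for x
    using der has_derivative_linear U'(2) that by blast
  \<comment> \<open>The inverse of the derivative is smooth in its base point.\<close>
  have H: "Ck_on k (\<lambda>x. inv (D x) v) U'" for k v
  proof (rule Ck_on_solve_linear_system[OF \<open>open U'\<close>])
    show "Ck_on k (\<lambda>x. matrix (D x) $ i $ j) U'" for i j
      using Ck_on_bounded_linear_compose[OF \<open>open U'\<close> bounded_linear_vec_nth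
          Ck_on_subset[OF DCk[of k "axis j 1"] U'(2)]]
      by (simp add: matrix_def)
    fix x assume x: "x \<in> U'"
    show "det (matrix (D x)) \<noteq> 0"
      using det_nz_iff_inj[OF linD[OF x]] bij_is_inj[OF bijD[OF x]] by simp
    show "matrix (D x) *v inv (D x) v = v"
      using matrix_vector_mul(2)[OF linD[OF x]] surj_f_inv_f[OF bij_is_surj[OF bijD[OF x]]]
      by metis
  qed
  have g: "Ck_on k g V" for k
  proof (induction k)
    case 0
    then show ?case using hom by (simp add: homeomorphism_def)
  next
    case (Suc k)
    have "Ck_on k (\<lambda>y. g' y v) V" for v
      by (rule Ck_on_cong[OF \<open>open V\<close> Ck_on_compose[OF \<open>open V\<close> Suc H[of k v]]])
        (use gU inv in auto)
    then show ?case
      by (intro Ck_on_SucI[OF \<open>open V\<close> g'])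
  qed
  have bb: "bij_betw \<phi> U' V"
    using hom by (intro bij_betw_byWitness[where f'=g]) (auto simp: homeomorphism_def)
  have "inv_into U' \<phi> y = g y" if "y \<in> V" for y
    using hom bb that gU[OF that] inv_into_f_f[of \<phi> U' "g y"]
    by (simp add: bij_betw_def homeomorphism_def)
  then have "Ck_on k (inv_into U' \<phi>) V" for k
    using Ck_on_cong[OF \<open>open V\<close> g] by force
  then have "diffeomorphism_between \<phi> U' V"
    using U' bb Ck_on_subset[OF Ck U'(2)] by (simp add: diffeomorphism_between_def smooth_on_def)
  then show thesis using that U' by blast
qed


section \<open>Partial derivatives, gradient and Laplacian\<close>

lemma partial_eqI: "(f has_derivative D) (at x) \<Longrightarrow> partial i f x = D (axis i 1)"
  using frechet_derivative_at by (fastforce simp: partial_def)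

lemma has_derivative_grad:
  assumes "f differentiable (at x)"
  shows "(f has_derivative (\<lambda>v. grad f x \<bullet> v)) (at x)"
proof -
  let ?D = "frechet_derivative f (at x)"
  have D: "(f has_derivative ?D) (at x)" using assms by (simp add: frechet_derivative_works)
  have "?D v = grad f x \<bullet> v" for v
  proof -
    have "?D (\<Sum>i\<in>UNIV. v $ i *\<^sub>R axis i 1) = (\<Sum>i\<in>UNIV. v $ i * ?D (axis i 1))"
      using has_derivative_linear[OF D] by (simp add: linear_sum linear_cmul)
    moreover have "(\<Sum>i\<in>UNIV. v $ i *\<^sub>R axis i 1) = v"
      by (simp add: vec_eq_iff axis_def if_distrib cong: if_cong)
    ultimately show ?thesis
      by (simp add: grad_def partial_def inner_vec_def mult.commute)
  qed
  then have "?D = (\<lambda>v. grad f x \<bullet> v)" by blast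
  then show ?thesis using D by simp
qed

lemma grad_eqI:
  assumes "(f has_derivative (\<lambda>v. g \<bullet> v)) (at x)"
  shows "grad f x = g"
  by (simp add: grad_def partial_eqI[OF assms] inner_axis vec_eq_iff)

lemma partial_cong_open:
  assumes "open S" "x \<in> S" "f differentiable (at x)" "\<And>y. y \<in> S \<Longrightarrow> f y = g y"
  shows "partial i f x = partial i g x"
  using frechet_derivative_transform_within_open[OF assms(3,1,2,4)] by (simp add: partial_def)

lemma partial_const: "partial i (\<lambda>x. c) x = 0"
  by (simp add: partial_def)

lemma partial_add:
  assumes "f differentiable (at x)" "g differentiable (at x)"
  shows "partial i (\<lambda>x. f x + g x) x = partial i f x + partial i g x"
  using partial_eqI[OF has_derivative_add] assms unfolding frechet_derivative_works
  by (fastforce simp: partial_def)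

lemma partial_sum:
  assumes "\<And>j. j \<in> I \<Longrightarrow> f j differentiable (at x)"
  shows "partial i (\<lambda>x. \<Sum>j\<in>I. f j x) x = (\<Sum>j\<in>I. partial i (f j) x)"
  using assms
  by (induction I rule: infinite_finite_induct) (auto simp: partial_add partial_const)

lemma partial_mult:
  assumes "f differentiable (at x)" "g differentiable (at x)"
  shows "partial i (\<lambda>x. f x * g x) x = f x * partial i g x + partial i f x * g x"
  using partial_eqI[OF has_derivative_mult] assms unfolding frechet_derivative_works
  by (fastforce simp: partial_def)

lemma Ck_on_differentiable: "Ck_on (Suc k) f S \<Longrightarrow> x \<in> S \<Longrightarrow> f differentiable (at x)"
  by simp

lemma Ck_on_partial: "Ck_on (Suc k) f S \<Longrightarrow> Ck_on k (partial i f) S"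
  by (simp add: partial_def[abs_def])

lemma partial_compose:
  fixes F :: "real^'n \<Rightarrow> real^'m"
  assumes F: "\<And>j. (\<lambda>x. F x $ j) differentiable (at x)" and u: "u differentiable (at (F x))"
  shows "partial i (\<lambda>x. u (F x)) x = (\<Sum>j\<in>UNIV. partial j u (F x) * partial i (\<lambda>x. F x $ j) x)"
proof -
  have "(F has_derivative (\<lambda>v. \<chi> j. grad (\<lambda>x. F x $ j) x \<bullet> v)) (at x)"
    unfolding has_derivative_componentwise_within[of F]
    using has_derivative_grad[OF F] by (auto simp: Basis_vec_def inner_axis)
  then have "((\<lambda>x. u (F x)) has_derivative
      (\<lambda>v. grad u (F x) \<bullet> (\<chi> j. grad (\<lambda>x. F x $ j) x \<bullet> v))) (at x)"
    using has_derivative_compose has_derivative_grad[OF u] by blast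
  then show ?thesis
    by (subst partial_eqI, assumption) (simp add: inner_vec_def grad_def inner_axis axis_def if_distrib cong: if_cong)
qed

lemma laplacian_mult:
  assumes f: "Ck_on 2 f UNIV" and g: "Ck_on 2 g UNIV"
  shows "laplacian (\<lambda>x. f x * g x) x =
    f x * laplacian g x + laplacian f x * g x + 2 * (grad f x \<bullet> grad g x)"
proof -
  note S = numeral_2_eq_2
  have d: "f differentiable (at y)" "g differentiable (at y)" for y
    using f g by (simp_all add: S)
  have d2: "partial i f differentiable (at y)" "partial i g differentiable (at y)" for y i
    using Ck_on_partial[of 1 f UNIV i] Ck_on_partial[of 1 g UNIV i] f g by (simp_all add: S)
  have "partial i (\<lambda>x. f x * g x) = (\<lambda>x. f x * partial i g x + partial i f x * g x)" for i
    using partial_mult d by blast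
  then show ?thesis
    by (simp add: laplacian_def partial_add partial_mult d d2 differentiable_mult sum.distrib
        inner_vec_def grad_def sum_distrib_left sum_distrib_right algebra_simps)
qed

lemma laplacian_add:
  assumes f: "Ck_on 2 f UNIV" and g: "Ck_on 2 g UNIV"
  shows "laplacian (\<lambda>x. f x + g x) x = laplacian f x + laplacian g x"
proof -
  note S = numeral_2_eq_2
  have d: "f differentiable (at y)" "g differentiable (at y)" for y
    using f g by (simp_all add: S)
  have d2: "partial i f differentiable (at y)" "partial i g differentiable (at y)" for y i
    using Ck_on_partial[of 1 f UNIV i] Ck_on_partial[of 1 g UNIV i] f g by (simp_all add: S)
  have "partial i (\<lambda>x. f x + g x) = (\<lambda>x. partial i f x + partial i g x)" for i
    using partial_add d by blast
  then show ?thesis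
    by (simp add: laplacian_def partial_add d2 sum.distrib)
qed

lemma laplacian_const: "laplacian (\<lambda>x. c) x = 0"
proof -
  have "partial i (\<lambda>x. c) = (\<lambda>x. 0)" for i :: 'a by (simp add: partial_const fun_eq_iff)
  then show ?thesis by (simp add: laplacian_def partial_const)
qed

text \<open>
  The mixed second derivatives of \<open>u\<close> are weighted by the Gram matrix of the gradients of the
  components of \<open>F\<close>; this is where horizontal conformality enters later.
\<close>

lemma laplacian_compose:
  fixes F :: "real^'n \<Rightarrow> real^'m"
  assumes "open W" "x \<in> W" and F: "\<And>j. Ck_on 2 (\<lambda>x. F x $ j) W"
    and u: "Ck_on 2 u V" and sub: "F ` W \<subseteq> V"
  shows "laplacian (\<lambda>x. u (F x)) x =
    (\<Sum>j\<in>UNIV. \<Sum>k\<in>UNIV. partial k (partial j u) (F x) *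
        (grad (\<lambda>x. F x $ k) x \<bullet> grad (\<lambda>x. F x $ j) x)) +
    (\<Sum>j\<in>UNIV. partial j u (F x) * laplacian (\<lambda>x. F x $ j) x)"
proof -
  note S = numeral_2_eq_2
  let ?F = "\<lambda>j x. F x $ j"
  have dF: "?F j differentiable (at y)" if "y \<in> W" for y j
    using F[of j] that by (simp add: S)
  have dF2: "partial i (?F j) differentiable (at y)" if "y \<in> W" for y i j
    using Ck_on_partial[of 1 "?F j" W i] F[of j] that by (simp add: S)
  have du: "u differentiable (at (F y))" if "y \<in> W" for y
    using u sub that by (auto simp: S)
  have du2: "partial j u differentiable (at (F y))" if "y \<in> W" for y j
    using Ck_on_partial[of 1 u V j] u sub that by (auto simp: S)
  have FW: "Ck_on 1 F W"
    using Ck_on_vec_lambda[OF \<open>open W\<close>] Ck_on_Suc_imp F by (metis One_nat_def S)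
  have dc: "(\<lambda>y. partial j u (F y)) differentiable (at y)" if "y \<in> W" for y j
    using Ck_on_compose[OF \<open>open W\<close> FW _ sub, of "partial j u"] Ck_on_partial[of 1 u V j] u that
    by (simp add: S)
  have 1: "partial i (\<lambda>x. u (F x)) y = (\<Sum>j\<in>UNIV. partial j u (F y) * partial i (?F j) y)"
    if "y \<in> W" for y i
    using partial_compose dF du that by blast
  have "partial i (partial i (\<lambda>x. u (F x))) x =
     partial i (\<lambda>y. \<Sum>j\<in>UNIV. partial j u (F y) * partial i (?F j) y) x" for i
    by (rule sym, rule partial_cong_open[OF \<open>open W\<close> \<open>x \<in> W\<close>])
      (auto intro!: differentiable_sum differentiable_mult simp: dc dF2 \<open>x \<in> W\<close> 1)
  also have "\<dots> i = (\<Sum>j\<in>UNIV. partial j u (F x) * partial i (partial i (?F j)) x +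
      (\<Sum>k\<in>UNIV. partial k (partial j u) (F x) * partial i (?F k) x) * partial i (?F j) x)" for i
    using partial_compose[of F x _ i] dF du2 dc dF2 \<open>x \<in> W\<close>
    by (simp add: partial_sum partial_mult differentiable_mult)
  finally have "laplacian (\<lambda>x. u (F x)) x = (\<Sum>i\<in>UNIV. \<Sum>j\<in>UNIV. partial j u (F x) * partial i (partial i (?F j)) x +
      (\<Sum>k\<in>UNIV. partial k (partial j u) (F x) * partial i (?F k) x) * partial i (?F j) x)"
    by (simp add: laplacian_def)
  also have "\<dots> = (\<Sum>j\<in>UNIV. \<Sum>i\<in>UNIV. partial j u (F x) * partial i (partial i (?F j)) x) +
      (\<Sum>j\<in>UNIV. \<Sum>k\<in>UNIV. \<Sum>i\<in>UNIV. partial k (partial j u) (F x) * (partial i (?F k) x * partial i (?F j) x))"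
  proof -
    have "(\<Sum>i\<in>UNIV. \<Sum>j\<in>UNIV. (\<Sum>k\<in>UNIV. partial k (partial j u) (F x) * partial i (?F k) x) * partial i (?F j) x) =
      (\<Sum>j\<in>UNIV. \<Sum>k\<in>UNIV. \<Sum>i\<in>UNIV. partial k (partial j u) (F x) * (partial i (?F k) x * partial i (?F j) x))"
      unfolding sum_distrib_right mult.assoc
      by (subst sum.swap) (intro sum.cong refl, rule sum.swap)
    moreover have "(\<Sum>i\<in>UNIV. \<Sum>j\<in>UNIV. partial j u (F x) * partial i (partial i (?F j)) x) =
      (\<Sum>j\<in>UNIV. \<Sum>i\<in>UNIV. partial j u (F x) * partial i (partial i (?F j)) x)"
      by (rule sum.swap)
    ultimately show ?thesis by (simp add: sum.distrib)
  qed
  finally show ?thesis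
    by (simp add: laplacian_def grad_def inner_vec_def sum_distrib_left)
qed

lemma has_derivative_norm_squared: "((\<lambda>x::'a::real_inner. (norm x)\<^sup>2) has_derivative (\<lambda>v. (2 *\<^sub>R x) \<bullet> v)) (at x)"
proof -
  have "((\<lambda>x::'a. x \<bullet> x) has_derivative (\<lambda>v. x \<bullet> v + v \<bullet> x)) (at x)"
    by (auto intro!: derivative_eq_intros)
  moreover have "(\<lambda>v. x \<bullet> v + v \<bullet> x) = (\<lambda>v. (2 *\<^sub>R x) \<bullet> v)"
    by (simp add: inner_commute fun_eq_iff)
  ultimately show ?thesis by (simp add: power2_norm_eq_inner)
qed

lemma grad_norm_squared: "grad (\<lambda>x::real^'n. (norm x)\<^sup>2) x = 2 *\<^sub>R x"
  by (rule grad_eqI[OF has_derivative_norm_squared])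

lemma laplacian_norm_squared: "laplacian (\<lambda>x::real^'n. (norm x)\<^sup>2) x = 2 * CARD('n)"
proof -
  have "partial i (\<lambda>x::real^'n. (norm x)\<^sup>2) = (\<lambda>x. 2 * x $ i)" for i
    by (simp add: fun_eq_iff partial_eqI[OF has_derivative_norm_squared] inner_axis)
  moreover have "partial i (\<lambda>x::real^'n. 2 * x $ i) x = 2" for i
  proof -
    have "((\<lambda>x::real^'n. 2 * x $ i) has_derivative (\<lambda>h. 2 * h $ i)) (at x)"
      by (intro bounded_linear_imp_has_derivative bounded_linear_const_mult bounded_linear_vec_nth)
    then show ?thesis by (simp add: partial_eqI)
  qed
  ultimately show ?thesis by (simp add: laplacian_def)
qed

lemma real_polynomial_function_norm_squared:
  "real_polynomial_function (\<lambda>x::real^'n. (norm x)\<^sup>2)"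
proof -
  have "real_polynomial_function (\<lambda>x::real^'n. \<Sum>i\<in>UNIV. x $ i * x $ i)"
    by (intro real_polynomial_function_sum real_polynomial_function.intros bounded_linear_vec_nth finite)
  moreover have "(norm x)\<^sup>2 = (\<Sum>i\<in>UNIV. x $ i * x $ i)" for x :: "real^'n"
    by (simp add: power2_norm_eq_inner inner_vec_def)
  ultimately show ?thesis by simp
qed


section \<open>Horizontally conformal maps with harmonic components\<close>

lemma smooth_on_component:
  fixes P :: "real^'n \<Rightarrow> real^'m"
  shows "smooth_on P UNIV \<Longrightarrow> Ck_on k (\<lambda>x. P x $ i) UNIV"
  by (rule Ck_on_bounded_linear_compose[OF open_UNIV bounded_linear_vec_nth])
    (simp add: smooth_on_def)

text \<open>
  The chain rule expands both gradients in the gradients of the components of \<open>P\<close>, which are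
  orthogonal of equal length.
\<close>

lemma grad_compose_inner_dilation:
  fixes P :: "real^'n \<Rightarrow> real^'m"
  assumes dil: "has_squared_dilation P L" and "smooth_on P UNIV"
    and u: "u differentiable (at (P x))" and v: "v differentiable (at (P x))"
  shows "grad (\<lambda>x. u (P x)) x \<bullet> grad (\<lambda>x. v (P x)) x = L x * (grad u (P x) \<bullet> grad v (P x))"
proof -
  have P: "(\<lambda>x. P x $ j) differentiable (at x)" for j
    using Ck_on_differentiable[OF smooth_on_component[OF assms(2)]] by blast
  have *: "grad (\<lambda>x. w (P x)) x = (\<Sum>j\<in>UNIV. partial j w (P x) *\<^sub>R grad (\<lambda>x. P x $ j) x)"
    if "w differentiable (at (P x))" for w
    by (simp add: vec_eq_iff grad_def partial_compose[OF P that])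
  have D: "grad (\<lambda>x. P x $ j) x \<bullet> grad (\<lambda>x. P x $ k) x = (if j = k then L x else 0)" for j k
    using dil by (simp add: has_squared_dilation_def)
  show ?thesis
    unfolding *[OF u] *[OF v]
    by (simp add: inner_sum_left inner_sum_right D if_distrib cong: if_cong)
      (simp add: inner_vec_def grad_def sum_distrib_left mult.commute mult.left_commute)
qed

text \<open>
  For orthogonal component gradients of equal length the second-order part of the chain rule
  collapses to a multiple of the Laplacian on the target, and for harmonic components the
  first-order part vanishes.
\<close>

lemma laplacian_compose_dilation:
  fixes P :: "real^'n \<Rightarrow> real^'m"
  assumes dil: "has_squared_dilation P L" and sm: "smooth_on P UNIV"
    and harm: "\<And>i x. laplacian (\<lambda>x. P x $ i) x = 0"
    and V: "open V" "Ck_on 2 u V" "P x \<in> V"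
  shows "laplacian (\<lambda>x. u (P x)) x = L x * laplacian u (P x)"
proof -
  have "continuous_on UNIV P" using sm Ck_on_imp_continuous_on by (auto simp: smooth_on_def)
  then have "open (P -` V)" using V(1) open_vimage by blast
  moreover have "Ck_on 2 (\<lambda>x. P x $ j) (P -` V)" for j
    using smooth_on_component[OF sm] Ck_on_subset by blast
  ultimately have 1: "laplacian (\<lambda>x. u (P x)) x =
    (\<Sum>j\<in>UNIV. \<Sum>k\<in>UNIV. partial k (partial j u) (P x) *
        (grad (\<lambda>x. P x $ k) x \<bullet> grad (\<lambda>x. P x $ j) x))"
    by (subst laplacian_compose[of "P -` V" x P u V]) (use V harm in auto)
  have D: "grad (\<lambda>x. P x $ j) x \<bullet> grad (\<lambda>x. P x $ k) x = (if j = k then L x else 0)" for j k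
    using dil by (simp add: has_squared_dilation_def)
  show ?thesis
    unfolding 1 D
    by (simp add: if_distrib laplacian_def sum_distrib_left mult.commute cong: if_cong)
qed

text \<open>
  This is the easy direction of the Fuglede--Ishihara characterization of harmonic morphisms.
\<close>

lemma harmonic_morphism_dilation:
  fixes P :: "real^'n \<Rightarrow> real^'m"
  assumes dil: "has_squared_dilation P L" and sm: "smooth_on P UNIV"
    and harm: "\<And>i x. laplacian (\<lambda>x. P x $ i) x = 0"
  shows "harmonic_morphism P"
  unfolding harmonic_morphism_def
proof (intro conjI sm allI impI)
  fix V and u :: "real^'m \<Rightarrow> real" assume "open V \<and> harmonic_on u V"
  then have V: "open V" "Ck_on 2 u V" and u0: "\<And>y. y \<in> V \<Longrightarrow> laplacian u y = 0"
    by (auto simp: harmonic_on_def)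
  have "continuous_on UNIV P" using sm Ck_on_imp_continuous_on by (auto simp: smooth_on_def)
  then have o: "open (P -` V)" using V(1) open_vimage by blast
  have "Ck_on 2 (\<lambda>x. u (P x)) (P -` V)"
    by (rule Ck_on_compose[OF o _ V(2)]) (use sm Ck_on_subset[of 2 P UNIV] in \<open>auto simp: smooth_on_def\<close>)
  then show "harmonic_on (u \<circ> P) (P -` V)"
    using laplacian_compose_dilation[OF dil sm harm V] u0 by (simp add: harmonic_on_def o_def)
qed


section \<open>Generated algebras\<close>

lemma subalgebraD:
  assumes "subalgebra S"
  shows "f \<in> S \<Longrightarrow> real_polynomial_function f" "(\<lambda>x. c) \<in> S"
    "f \<in> S \<Longrightarrow> g \<in> S \<Longrightarrow> (\<lambda>x. f x + g x) \<in> S" "f \<in> S \<Longrightarrow> g \<in> S \<Longrightarrow> (\<lambda>x. f x * g x) \<in> S"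
  using assms by (auto simp: subalgebra_def)

lemma subalgebra_polynomials: "subalgebra {f. real_polynomial_function f}"
  by (auto simp: subalgebra_def)

lemma subalgebra_generated_algebra:
  assumes "G \<subseteq> {f. real_polynomial_function f}"
  shows "subalgebra (generated_algebra G)"
proof -
  have "generated_algebra G \<subseteq> {f. real_polynomial_function f}"
    unfolding generated_algebra_def by (rule hull_minimal[OF assms, of subalgebra, OF subalgebra_polynomials])
  then show ?thesis
    by (auto simp: subalgebra_def generated_algebra_def hull_def)
qed

lemma generated_algebra_induct [consumes 2, case_names const gen add mult]:
  assumes "f \<in> generated_algebra G" and G: "G \<subseteq> {f. real_polynomial_function f}"
    and "\<And>c. Pr (\<lambda>x. c)" and "\<And>g. g \<in> G \<Longrightarrow> Pr g"
    and "\<And>f g. f \<in> generated_algebra G \<Longrightarrow> g \<in> generated_algebra G \<Longrightarrow> Pr f \<Longrightarrow> Pr g \<Longrightarrow> Pr (\<lambda>x. f x + g x)"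
    and "\<And>f g. f \<in> generated_algebra G \<Longrightarrow> g \<in> generated_algebra G \<Longrightarrow> Pr f \<Longrightarrow> Pr g \<Longrightarrow> Pr (\<lambda>x. f x * g x)"
  shows "Pr f"
proof -
  note S = subalgebra_generated_algebra[OF G]
  have "subalgebra {f \<in> generated_algebra G. Pr f}"
    unfolding subalgebra_def using subalgebraD[OF S] assms(3,5,6) by auto
  moreover have "G \<subseteq> {f \<in> generated_algebra G. Pr f}"
    using assms(4) by (auto simp: generated_algebra_def hull_inc)
  ultimately have "generated_algebra G \<subseteq> {f \<in> generated_algebra G. Pr f}"
    unfolding generated_algebra_def[of G, symmetric] by (metis generated_algebra_def hull_minimal)
  then show ?thesis using assms(1) by blast
qed

lemma grad_inner_add_left:
  "f differentiable (at x) \<Longrightarrow> g differentiable (at x) \<Longrightarrow>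
    grad (\<lambda>x. f x + g x) x \<bullet> v = grad f x \<bullet> v + grad g x \<bullet> v"
  by (simp add: grad_def partial_add inner_vec_def sum.distrib distrib_right)

lemma grad_inner_mult_left:
  "f differentiable (at x) \<Longrightarrow> g differentiable (at x) \<Longrightarrow>
    grad (\<lambda>x. f x * g x) x \<bullet> v = f x * (grad g x \<bullet> v) + (grad f x \<bullet> v) * g x"
  by (simp add: grad_def partial_mult inner_vec_def sum.distrib sum_distrib_left sum_distrib_right algebra_simps)

lemma grad_const: "grad (\<lambda>x. c) x = 0"
  by (simp add: grad_def partial_const vec_eq_iff)

lemma real_polynomial_function_differentiable:
  fixes f :: "real^'n \<Rightarrow> real"
  shows "real_polynomial_function f \<Longrightarrow> f differentiable (at x)"
  using real_polynomial_function_Ck_on[of f UNIV 1] by simp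

text \<open>
  For fixed \<open>h\<close>, pairing with the gradient of \<open>h\<close> is a derivation, so the elements it maps into the
  generated algebra form a subalgebra.
\<close>

lemma grad_inner_closed_generated_left:
  assumes G: "G \<subseteq> {f. real_polynomial_function f}"
    and f: "f \<in> generated_algebra G"
    and gen: "\<And>g. g \<in> G \<Longrightarrow> (\<lambda>x. grad g x \<bullet> grad h x) \<in> generated_algebra G"
  shows "(\<lambda>x. grad f x \<bullet> grad h x) \<in> generated_algebra G"
  using f G
proof (induction rule: generated_algebra_induct)
  note S = subalgebraD[OF subalgebra_generated_algebra[OF G]]
  note diff = real_polynomial_function_differentiable[OF S(1)]
  { case (const c)
    show ?case by (simp add: grad_const S(2))
  next
    case (gen g)
    then show ?case by (rule assms(3))
  next
    case (add f g)
    then show ?case by (simp add: grad_inner_add_left[OF diff diff] S(3))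
  next
    case (mult f g)
    then show ?case by (simp add: grad_inner_mult_left[OF diff diff] S(3,4)) }
qed

text \<open>
  The pairing of gradients is a derivation in each argument, so the one-sided statement is applied
  twice: for a generator in the second slot, then for an arbitrary element there.
\<close>

lemma grad_inner_closed_generated:
  assumes G: "G \<subseteq> {f. real_polynomial_function f}"
    and gen: "\<And>g h. g \<in> G \<Longrightarrow> h \<in> G \<Longrightarrow> (\<lambda>x. grad g x \<bullet> grad h x) \<in> generated_algebra G"
    and f: "f \<in> generated_algebra G" and g: "g \<in> generated_algebra G"
  shows "(\<lambda>x. grad f x \<bullet> grad g x) \<in> generated_algebra G"
proof -
  have "(\<lambda>x. grad g x \<bullet> grad h x) \<in> generated_algebra G" if "h \<in> G" for h
    by (rule grad_inner_closed_generated_left[OF G g gen[OF _ that]])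
  then show ?thesis
    by (intro grad_inner_closed_generated_left[OF G f]) (simp add: inner_commute)
qed

text \<open>
  The Laplacian is a second-order operator: it fails the Leibniz rule only by the term
  \<open>2 * (grad f x \<bullet> grad g x)\<close>. Once that pairing preserves the algebra, preservation by the
  Laplacian also has to be tested on generators only.
\<close>

lemma laplacian_closed_generated:
  assumes G: "G \<subseteq> {f. real_polynomial_function f}"
    and grad: "\<And>g h. g \<in> G \<Longrightarrow> h \<in> G \<Longrightarrow> (\<lambda>x. grad g x \<bullet> grad h x) \<in> generated_algebra G"
    and lap: "\<And>g. g \<in> G \<Longrightarrow> laplacian g \<in> generated_algebra G"
    and f: "f \<in> generated_algebra G"
  shows "laplacian f \<in> generated_algebra G"
proof -
  note S = subalgebraD[OF subalgebra_generated_algebra[OF G]]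
  note Ck = real_polynomial_function_Ck_on[OF S(1) open_UNIV, of _ 2]
  have "(\<lambda>x. laplacian f x) \<in> generated_algebra G"
    using f G
  proof (induction rule: generated_algebra_induct)
    case (const c)
    show ?case by (simp add: laplacian_const S(2))
  next
    case (gen g)
    then show ?case by (simp add: lap)
  next
    case (add f g)
    then show ?case by (simp add: laplacian_add[OF Ck Ck] S(3))
  next
    case (mult f g)
    then show ?case
      by (simp add: laplacian_mult[OF Ck Ck])
        (intro S(3,4) S(2) grad_inner_closed_generated[OF G grad]; simp)
  qed
  then show ?thesis by simp
qed

text \<open>
  The same failure of the Leibniz rule, read backwards, recovers the pairing of gradients from the
  Laplacian by polarization.
\<close>

lemma laplacian_algebra_grad_inner:
  assumes "laplacian_algebra S" "u \<in> S" "v \<in> S"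
  shows "(\<lambda>x. grad u x \<bullet> grad v x) \<in> S"
proof -
  have S: "subalgebra S" and L: "\<And>f. f \<in> S \<Longrightarrow> laplacian f \<in> S"
    using assms(1) by (auto simp: laplacian_algebra_def)
  note S = subalgebraD[OF S]
  note Ck = real_polynomial_function_Ck_on[OF S(1) open_UNIV, of _ 2]
  have "(\<lambda>x. (1/2) * (laplacian (\<lambda>x. u x * v x) x + (- 1) * (u x * laplacian v x + laplacian u x * v x))) \<in> S"
    by (intro S(2-4) L assms)
  moreover have "(1/2) * (laplacian (\<lambda>x. u x * v x) x + (- 1) * (u x * laplacian v x + laplacian u x * v x))
     = grad u x \<bullet> grad v x" for x
    by (simp add: laplacian_mult[OF Ck Ck] assms)
  ultimately show ?thesis by simp
qed


section \<open>Homogeneous polynomials\<close>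

lemma finite_multi_indices: "finite {\<alpha> :: 'n::finite \<Rightarrow> nat. (\<Sum>i\<in>UNIV. \<alpha> i) = d}"
proof -
  have "\<alpha> i \<le> d" if "(\<Sum>i\<in>UNIV. \<alpha> i) = d" for \<alpha> :: "'n \<Rightarrow> nat" and i
    using that member_le_sum[of i UNIV \<alpha>] by simp
  then have "{\<alpha> :: 'n \<Rightarrow> nat. (\<Sum>i\<in>UNIV. \<alpha> i) = d} \<subseteq> (\<Pi>\<^sub>E i\<in>UNIV. {..d})"
    by auto
  then show ?thesis by (rule finite_subset) (simp add: finite_PiE)
qed

lemma homogeneous_poly_zero: "homogeneous_poly d (\<lambda>x. 0)"
  unfolding homogeneous_poly_def by (rule exI[of _ "\<lambda>\<alpha>. 0"]) simp

lemma homogeneous_poly_add: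
  assumes "homogeneous_poly d f" "homogeneous_poly d g"
  shows "homogeneous_poly d (\<lambda>x. f x + g x)"
proof -
  obtain c e where "f = (\<lambda>x. \<Sum>\<alpha> | (\<Sum>i\<in>UNIV. \<alpha> i) = d. c \<alpha> * (\<Prod>i\<in>UNIV. (x $ i) ^ \<alpha> i))"
    "g = (\<lambda>x. \<Sum>\<alpha> | (\<Sum>i\<in>UNIV. \<alpha> i) = d. e \<alpha> * (\<Prod>i\<in>UNIV. (x $ i) ^ \<alpha> i))"
    using assms by (auto simp: homogeneous_poly_def)
  then show ?thesis unfolding homogeneous_poly_def
    by (intro exI[of _ "\<lambda>\<alpha>. c \<alpha> + e \<alpha>"]) (simp add: sum.distrib algebra_simps)
qed

lemma homogeneous_poly_sum:
  "(\<And>i. i \<in> I \<Longrightarrow> homogeneous_poly d (f i)) \<Longrightarrow> homogeneous_poly d (\<lambda>x. \<Sum>i\<in>I. f i x)"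
  by (induction I rule: infinite_finite_induct) (auto intro: homogeneous_poly_zero homogeneous_poly_add)

text \<open>
  The coefficient of a monomial in the product is collected over all splittings of its exponent
  into exponents of degrees \<open>a\<close> and \<open>b\<close>.
\<close>

lemma homogeneous_poly_mult:
  fixes f g :: "real^'n \<Rightarrow> real"
  assumes "homogeneous_poly a f" "homogeneous_poly b g"
  shows "homogeneous_poly (a + b) (\<lambda>x. f x * g x)"
proof -
  let ?I = "\<lambda>d. {\<alpha> :: 'n \<Rightarrow> nat. (\<Sum>i\<in>UNIV. \<alpha> i) = d}"
  let ?M = "\<lambda>\<alpha> (x :: real^'n). \<Prod>i\<in>UNIV. (x $ i) ^ \<alpha> i"
  let ?add = "\<lambda>(\<alpha>, \<beta>). (\<lambda>i. \<alpha> i + \<beta> i) :: 'n \<Rightarrow> nat"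
  obtain c e where f: "f = (\<lambda>x. \<Sum>\<alpha>\<in>?I a. c \<alpha> * ?M \<alpha> x)"
    and g: "g = (\<lambda>x. \<Sum>\<beta>\<in>?I b. e \<beta> * ?M \<beta> x)"
    using assms by (auto simp: homogeneous_poly_def)
  define k where "k \<gamma> = (\<Sum>p | p \<in> ?I a \<times> ?I b \<and> ?add p = \<gamma>. c (fst p) * e (snd p))" for \<gamma>
  have "f x * g x = (\<Sum>\<gamma>\<in>?I (a + b). k \<gamma> * ?M \<gamma> x)" for x
  proof -
    have "f x * g x = (\<Sum>p\<in>?I a \<times> ?I b. c (fst p) * e (snd p) * ?M (?add p) x)"
      by (simp add: f g sum_product sum.cartesian_product case_prod_beta power_add prod.distrib algebra_simps)
    also have "\<dots> = (\<Sum>\<gamma>\<in>?I (a + b). \<Sum>p | p \<in> ?I a \<times> ?I b \<and> ?add p = \<gamma>. c (fst p) * e (snd p) * ?M (?add p) x)"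
      by (rule sum.group[symmetric])
        (auto simp: finite_multi_indices sum.distrib)
    also have "\<dots> = (\<Sum>\<gamma>\<in>?I (a + b). k \<gamma> * ?M \<gamma> x)"
      unfolding k_def sum_distrib_right by (intro sum.cong) auto
    finally show ?thesis .
  qed
  then show ?thesis unfolding homogeneous_poly_def by (intro exI[of _ k]) (simp add: fun_eq_iff)
qed

lemma homogeneous_poly_const: "homogeneous_poly 0 (\<lambda>x::real^'n. c)"
proof -
  have "{\<alpha> :: 'n \<Rightarrow> nat. (\<Sum>i\<in>UNIV. \<alpha> i) = 0} = {\<lambda>i. 0}" by auto
  then show ?thesis unfolding homogeneous_poly_def by (intro exI[of _ "\<lambda>\<alpha>. c"]) simp
qed

lemma homogeneous_poly_cmult: "homogeneous_poly d f \<Longrightarrow> homogeneous_poly d (\<lambda>x. c * f x)"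
  using homogeneous_poly_mult[OF homogeneous_poly_const] by fastforce

lemma homogeneous_poly_component: "homogeneous_poly 1 (\<lambda>x::real^'n. x $ i)"
proof -
  let ?e = "\<lambda>j. if j = i then 1 else 0 :: nat"
  have 1: "(\<Prod>j\<in>UNIV. (x $ j) ^ ?e j) = x $ i" for x :: "real^'n"
  proof -
    have "(x $ j) ^ ?e j = (if j = i then x $ j else 1)" for j by simp
    then show ?thesis by (simp only: prod.delta finite UNIV_I if_True)
  qed
  show ?thesis unfolding homogeneous_poly_def
    by (rule exI[of _ "\<lambda>\<alpha>. if \<alpha> = ?e then 1 else 0"])
      (use 1 in \<open>simp add: if_distrib[of "\<lambda>c. c * _"] finite_multi_indices cong: if_cong\<close>)
qed

lemma homogeneous_poly_prod:
  "(\<And>i. i \<in> I \<Longrightarrow> homogeneous_poly (d i) (f i)) \<Longrightarrow>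
    homogeneous_poly (\<Sum>i\<in>I. d i) (\<lambda>x. \<Prod>i\<in>I. f i x)"
  by (induction I rule: infinite_finite_induct)
    (auto intro: homogeneous_poly_const homogeneous_poly_mult)

lemma homogeneous_poly_power: "homogeneous_poly d f \<Longrightarrow> homogeneous_poly (d * k) (\<lambda>x. f x ^ k)"
  by (induction k) (auto intro: homogeneous_poly_const homogeneous_poly_mult)

lemma homogeneous_poly_compose:
  fixes u :: "real^'m \<Rightarrow> real" and F :: "real^'n \<Rightarrow> real^'m"
  assumes "homogeneous_poly d u" "\<And>i. homogeneous_poly e (\<lambda>x. F x $ i)"
  shows "homogeneous_poly (e * d) (\<lambda>x. u (F x))"
proof -
  obtain c where u: "u = (\<lambda>x. \<Sum>\<alpha> | (\<Sum>i\<in>UNIV. \<alpha> i) = d. c \<alpha> * (\<Prod>i\<in>UNIV. (x $ i) ^ \<alpha> i))"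
    using assms(1) by (auto simp: homogeneous_poly_def)
  have "homogeneous_poly (e * d) (\<lambda>x. \<Prod>i\<in>UNIV. (F x $ i) ^ \<alpha> i)" if "(\<Sum>i\<in>UNIV. \<alpha> i) = d" for \<alpha>
    using homogeneous_poly_prod[of UNIV "\<lambda>i. e * \<alpha> i", OF homogeneous_poly_power[OF assms(2)]] that
    by (simp add: sum_distrib_left[symmetric])
  then show ?thesis
    unfolding u by (intro homogeneous_poly_sum homogeneous_poly_cmult) simp
qed

lemma homogeneous_poly_real_polynomial_function:
  "homogeneous_poly d f \<Longrightarrow> real_polynomial_function f"
  unfolding homogeneous_poly_def
  by (auto intro!: real_polynomial_function_sum real_polynomial_function.intros(2,4)
      real_polynomial_function_prod real_polynomial_function_power finite_multi_indices
      real_polynomial_function.intros(1)[OF bounded_linear_vec_nth])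

lemma homogeneous_poly_scaleR:
  assumes "homogeneous_poly d f"
  shows "f (t *\<^sub>R x) = t ^ d * f x"
proof -
  obtain c where f: "f = (\<lambda>x. \<Sum>\<alpha> | (\<Sum>i\<in>UNIV. \<alpha> i) = d. c \<alpha> * (\<Prod>i\<in>UNIV. (x $ i) ^ \<alpha> i))"
    using assms by (auto simp: homogeneous_poly_def)
  show ?thesis
    by (auto simp: f sum_distrib_left power_mult_distrib prod.distrib power_sum[symmetric] intro!: sum.cong)
qed

text \<open>
  Euler's identity: both sides are the derivative at \<open>t = 1\<close> of \<open>f (t *\<^sub>R x) = t ^ d * f x\<close>.
\<close>

lemma homogeneous_poly_euler:
  assumes "homogeneous_poly d f"
  shows "grad f x \<bullet> x = d * f x"
proof -
  have "f differentiable (at (1 *\<^sub>R x))"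
    using homogeneous_poly_real_polynomial_function[OF assms] real_polynomial_function_differentiable by blast
  note D = has_derivative_grad[OF this]
  have "((\<lambda>t. t *\<^sub>R x) has_derivative (\<lambda>h. h *\<^sub>R x)) (at 1)"
    by (auto intro!: derivative_eq_intros)
  from has_derivative_compose[OF this D]
  have "((\<lambda>t. f (t *\<^sub>R x)) has_derivative (\<lambda>h. grad f x \<bullet> (h *\<^sub>R x))) (at 1)"
    unfolding scaleR_one .
  moreover have "((\<lambda>t. t ^ d * f x) has_derivative (\<lambda>h. h * (d * f x))) (at 1)"
    by (auto intro!: derivative_eq_intros)
  ultimately have "(\<lambda>h. grad f x \<bullet> (h *\<^sub>R x)) = (\<lambda>h. h * (d * f x))"
    unfolding homogeneous_poly_scaleR[OF assms] by (rule has_derivative_unique)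
  then show ?thesis by (metis mult_1 scaleR_one)
qed


section \<open>Gradedness of generated algebras\<close>

definition sum_of_homogeneous_in :: "(real^'n \<Rightarrow> real) set \<Rightarrow> (real^'n \<Rightarrow> real) \<Rightarrow> bool"
  where "sum_of_homogeneous_in S f \<longleftrightarrow>
    (\<exists>n g. (\<forall>d\<le>n. homogeneous_poly d (g d) \<and> g d \<in> S) \<and> f = (\<lambda>x. \<Sum>d\<le>(n::nat). g d x))"

lemma sum_of_homogeneous_in_homogeneous:
  assumes S: "subalgebra S" and "homogeneous_poly d f" "f \<in> S"
  shows "sum_of_homogeneous_in S f"
proof -
  have "(\<Sum>e\<le>d. (if e = d then f else (\<lambda>x. 0)) x) = f x" for x
    by (simp add: if_distrib[of "\<lambda>h. h x"] cong: if_cong)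
  then show ?thesis unfolding sum_of_homogeneous_in_def
    by (intro exI[of _ d] exI[of _ "\<lambda>e. if e = d then f else (\<lambda>x. 0)"])
      (use assms subalgebraD(2)[OF S] homogeneous_poly_zero in auto)
qed

text \<open>
  The two decompositions may stop at different degrees; the shorter one is continued by zero.
\<close>

lemma sum_of_homogeneous_in_add:
  assumes S: "subalgebra S" and "sum_of_homogeneous_in S f" "sum_of_homogeneous_in S f'"
  shows "sum_of_homogeneous_in S (\<lambda>x. f x + f' x)"
proof -
  obtain n g n' g' where
    g: "\<And>d. d \<le> n \<Longrightarrow> homogeneous_poly d (g d) \<and> g d \<in> S" and f: "f = (\<lambda>x. \<Sum>d\<le>n. g d x)" and
    g': "\<And>d. d \<le> n' \<Longrightarrow> homogeneous_poly d (g' d) \<and> g' d \<in> S" and f': "f' = (\<lambda>x. \<Sum>d\<le>n'. g' d x)"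
    using assms(2,3) unfolding sum_of_homogeneous_in_def by metis
  let ?h = "\<lambda>n g d. if d \<le> n then g d else (\<lambda>x. 0)"
  have ext: "(\<Sum>d\<le>N. ?h n g d x) = (\<Sum>d\<le>n. g d x)" if "n \<le> N" for N n :: nat and g :: "nat \<Rightarrow> real^'a \<Rightarrow> real" and x
    using that by (intro sum.mono_neutral_cong_right) auto
  have "homogeneous_poly d (\<lambda>x. ?h n g d x + ?h n' g' d x) \<and> (\<lambda>x. ?h n g d x + ?h n' g' d x) \<in> S" for d
    using g g' subalgebraD[OF S] homogeneous_poly_zero
    by (intro conjI homogeneous_poly_add subalgebraD(3)[OF S]) auto
  moreover have "(\<lambda>x. f x + f' x) = (\<lambda>x. \<Sum>d\<le>max n n'. ?h n g d x + ?h n' g' d x)"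
    by (simp add: sum.distrib ext f f')
  ultimately show ?thesis unfolding sum_of_homogeneous_in_def
    by (intro exI[of _ "max n n'"] exI[of _ "\<lambda>d x. ?h n g d x + ?h n' g' d x"]) blast
qed

lemma sum_of_homogeneous_in_sum:
  assumes S: "subalgebra S" and "\<And>i. i \<in> I \<Longrightarrow> sum_of_homogeneous_in S (f i)"
  shows "sum_of_homogeneous_in S (\<lambda>x. \<Sum>i\<in>I. f i x)"
  using assms(2)
  by (induction I rule: infinite_finite_induct)
    (auto intro!: sum_of_homogeneous_in_add[OF S]
      sum_of_homogeneous_in_homogeneous[OF S homogeneous_poly_zero subalgebraD(2)[OF S]])

lemma sum_of_homogeneous_in_mult:
  assumes S: "subalgebra S" and "sum_of_homogeneous_in S f" "sum_of_homogeneous_in S f'"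
  shows "sum_of_homogeneous_in S (\<lambda>x. f x * f' x)"
proof -
  obtain n g n' g' where
    g: "\<And>d. d \<le> n \<Longrightarrow> homogeneous_poly d (g d) \<and> g d \<in> S" and f: "f = (\<lambda>x. \<Sum>d\<le>n. g d x)" and
    g': "\<And>d. d \<le> n' \<Longrightarrow> homogeneous_poly d (g' d) \<and> g' d \<in> S" and f': "f' = (\<lambda>x. \<Sum>d\<le>n'. g' d x)"
    using assms(2,3) unfolding sum_of_homogeneous_in_def by metis
  have "sum_of_homogeneous_in S (\<lambda>x. \<Sum>i\<le>n. \<Sum>j\<le>n'. g i x * g' j x)"
  proof (intro sum_of_homogeneous_in_sum[OF S])
    fix i j assume "i \<in> {..n}" "j \<in> {..n'}"
    then show "sum_of_homogeneous_in S (\<lambda>x. g i x * g' j x)"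
      using g[of i] g'[of j]
      by (intro sum_of_homogeneous_in_homogeneous[OF S homogeneous_poly_mult subalgebraD(4)[OF S]]) auto
  qed
  then show ?thesis by (simp add: f f' sum_product)
qed

lemma graded_generated_algebra:
  assumes G: "G \<subseteq> {f. real_polynomial_function f}"
    and gen: "\<And>g. g \<in> G \<Longrightarrow> sum_of_homogeneous_in (generated_algebra G) g"
  shows "graded (generated_algebra G)"
proof -
  note S = subalgebra_generated_algebra[OF G]
  have "sum_of_homogeneous_in (generated_algebra G) f" if "f \<in> generated_algebra G" for f
    using that G
  proof (induction rule: generated_algebra_induct)
    case (const c)
    show ?case
      by (rule sum_of_homogeneous_in_homogeneous[OF S homogeneous_poly_const subalgebraD(2)[OF S]])
  qed (auto intro: gen sum_of_homogeneous_in_add[OF S] sum_of_homogeneous_in_mult[OF S])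
  then show ?thesis by (auto simp: graded_def sum_of_homogeneous_in_def)
qed


section \<open>Pullback of a Laplacian algebra\<close>

lemma homogeneous_poly_norm_squared: "homogeneous_poly 2 (\<lambda>x::real^'n. (norm x)\<^sup>2)"
proof -
  have "homogeneous_poly (1 + 1) (\<lambda>x::real^'n. \<Sum>i\<in>UNIV. x $ i * x $ i)"
    by (intro homogeneous_poly_sum homogeneous_poly_mult homogeneous_poly_component)
  then show ?thesis
    by (simp only: power2_norm_eq_inner inner_vec_def inner_real_def one_add_one)
qed

text \<open>
  It suffices to evaluate the Laplacian and the pairing of gradients on the generators
  \<open>R x = (norm x)\<^sup>2\<close> and \<open>u \<circ> P\<close>. On pullbacks both are \<open>c R\<close> times the pullback of the
  corresponding operation on \<open>S\<close>. On \<open>R\<close> they give \<open>2 * CARD('n)\<close> and \<open>4 R\<close>. The mixed pairing is twice the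
  derivative of \<open>u \<circ> P\<close> in the radial direction. Since \<open>P\<close> is quadratic, this is four times the
  pullback of the radial derivative of \<open>u\<close>, that is, twice the pullback of the pairing of \<open>u\<close> with
  the squared norm of the target. This last pairing lies in \<open>S\<close> because the squared norm does.
\<close>

lemma laplacian_algebra_generated_pullback:
  fixes P :: "real^'n \<Rightarrow> real^'m" and S :: "(real^'m \<Rightarrow> real) set"
  assumes S: "laplacian_algebra S"
    and hom: "\<And>i. homogeneous_poly 2 (\<lambda>x. P x $ i)"
    and dil: "has_squared_dilation P (\<lambda>x. c * (norm x)\<^sup>2)"
    and harm: "\<And>i x. laplacian (\<lambda>x. P x $ i) x = 0"
  shows "laplacian_algebra (generated_algebra (insert (\<lambda>x. (norm x)\<^sup>2) (pullback P S)))"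
proof -
  let ?R = "\<lambda>x::real^'n. (norm x)\<^sup>2" and ?r = "\<lambda>y::real^'m. (norm y)\<^sup>2"
  let ?G = "insert ?R (pullback P S)"
  let ?T = "generated_algebra ?G"
  have subS: "subalgebra S" and grS: "graded S" and rS: "?r \<in> S"
    and lapS: "\<And>u. u \<in> S \<Longrightarrow> laplacian u \<in> S"
    using S by (auto simp: laplacian_algebra_def)
  note Sd = subalgebraD[OF subS]
  have sm: "smooth_on P UNIV"
    unfolding smooth_on_def
    by (intro allI Ck_on_vec_lambda open_UNIV real_polynomial_function_Ck_on
        homogeneous_poly_real_polynomial_function[OF hom])
  have Ppoly: "polynomial_function P"
    unfolding polynomial_function_iff_Basis_inner
    using homogeneous_poly_real_polynomial_function[OF hom]
    by (auto simp: Basis_vec_def inner_axis real_polynomial_function_eq)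
  have G: "?G \<subseteq> {f. real_polynomial_function f}"
    using real_polynomial_function_norm_squared real_polynomial_function_compose[OF Ppoly Sd(1)]
    by (auto simp: pullback_def)
  note T = subalgebra_generated_algebra[OF G]
  note Td = subalgebraD[OF T]
  have genG: "f \<in> ?G \<Longrightarrow> f \<in> ?T" for f by (simp add: generated_algebra_def hull_inc)
  have RT: "?R \<in> ?T" by (rule genG) simp
  have PT: "(\<lambda>x. u (P x)) \<in> ?T" if "u \<in> S" for u
    using that by (intro genG) (auto simp: pullback_def o_def)
  have diffS: "u differentiable (at y)" if "u \<in> S" for u y
    using real_polynomial_function_differentiable[OF Sd(1)[OF that]] .
  have lap: "laplacian (\<lambda>x. u (P x)) \<in> ?T" if "u \<in> S" for u
  proof -
    have "laplacian (\<lambda>x. u (P x)) = (\<lambda>x. c * (?R x * laplacian u (P x)))"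
      using laplacian_compose_dilation[OF dil sm harm open_UNIV
          real_polynomial_function_Ck_on[OF Sd(1)[OF that] open_UNIV]] by (simp add: fun_eq_iff)
    also have "\<dots> \<in> ?T" by (intro Td(2,4) RT PT[OF lapS[OF that]])
    finally show ?thesis .
  qed
  have grPP: "(\<lambda>x. grad (\<lambda>x. u (P x)) x \<bullet> grad (\<lambda>x. v (P x)) x) \<in> ?T" if uv: "u \<in> S" "v \<in> S" for u v
  proof -
    have "(\<lambda>x. c * (?R x * (grad u (P x) \<bullet> grad v (P x)))) \<in> ?T"
      by (intro Td(2,4) RT PT[OF laplacian_algebra_grad_inner[OF S uv]])
    then show ?thesis
      by (simp add: grad_compose_inner_dilation[OF dil sm diffS diffS] uv mult.assoc)
  qed
  have grRP: "(\<lambda>x. grad ?R x \<bullet> grad (\<lambda>x. u (P x)) x) \<in> ?T" if u: "u \<in> S" for u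
  proof -
    have "grad ?R x \<bullet> grad (\<lambda>x. u (P x)) x = 2 * (grad ?r (P x) \<bullet> grad u (P x))" for x
    proof -
      have "grad (\<lambda>x. u (P x)) x \<bullet> x = (\<Sum>j\<in>UNIV. partial j u (P x) * (grad (\<lambda>x. P x $ j) x \<bullet> x))"
      proof -
        have "grad (\<lambda>x. u (P x)) x = (\<Sum>j\<in>UNIV. partial j u (P x) *\<^sub>R grad (\<lambda>x. P x $ j) x)"
          by (simp add: vec_eq_iff grad_def partial_compose[OF _ diffS[OF u]]
              real_polynomial_function_differentiable homogeneous_poly_real_polynomial_function[OF hom])
        then show ?thesis by (simp add: inner_sum_left)
      qed
      also have "\<dots> = 2 * (grad u (P x) \<bullet> P x)"
        unfolding homogeneous_poly_euler[OF hom]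
        by (simp add: inner_vec_def grad_def sum_distrib_left algebra_simps)
      finally show ?thesis by (simp add: grad_norm_squared inner_commute)
    qed
    moreover have "(\<lambda>x. 2 * (grad ?r (P x) \<bullet> grad u (P x))) \<in> ?T"
      by (intro Td(2,4) PT[OF laplacian_algebra_grad_inner[OF S rS u]])
    ultimately show ?thesis by simp
  qed
  have "grad ?R x \<bullet> grad ?R x = 4 * ?R x" for x
    unfolding grad_norm_squared by (simp add: power2_norm_eq_inner)
  moreover have "(\<lambda>x. 4 * ?R x) \<in> ?T" by (intro Td(2,4) RT)
  ultimately have grRR: "(\<lambda>x. grad ?R x \<bullet> grad ?R x) \<in> ?T" by simp
  have grad: "(\<lambda>x. grad g x \<bullet> grad h x) \<in> ?T" if "g \<in> ?G" "h \<in> ?G" for g h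
    using that grRR grRP grPP by (auto simp: pullback_def o_def inner_commute)
  have lapG: "laplacian g \<in> ?T" if "g \<in> ?G" for g
  proof -
    have "laplacian ?R = (\<lambda>x. real (2 * CARD('n)))" by (simp add: laplacian_norm_squared fun_eq_iff)
    then show ?thesis using that lap Td(2) by (auto simp: pullback_def o_def)
  qed
  have "graded ?T"
  proof (rule graded_generated_algebra[OF G])
    fix g assume "g \<in> ?G"
    then consider "g = ?R" | u where "u \<in> S" "g = (\<lambda>x. u (P x))" by (auto simp: pullback_def o_def)
    then show "sum_of_homogeneous_in ?T g"
    proof cases
      case 1
      then show ?thesis
        using sum_of_homogeneous_in_homogeneous[OF T homogeneous_poly_norm_squared RT] by simp
    next
      case 2
      then obtain n h where h: "\<And>d. d \<le> n \<Longrightarrow> homogeneous_poly d (h d) \<and> h d \<in> S"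
        and u: "u = (\<lambda>x. \<Sum>d\<le>(n::nat). h d x)"
        using grS unfolding graded_def by metis
      have "sum_of_homogeneous_in ?T (\<lambda>x. \<Sum>d\<le>n. h d (P x))"
        by (intro sum_of_homogeneous_in_sum[OF T]
            sum_of_homogeneous_in_homogeneous[OF T homogeneous_poly_compose[OF _ hom] PT])
          (use h in auto)
      then show ?thesis by (simp add: 2 u)
    qed
  qed
  then show ?thesis
    using T RT laplacian_closed_generated[OF G grad lapG] by (simp add: laplacian_algebra_def)
qed


section \<open>Quadratic maps of Clifford systems\<close>

locale clifford_system =
  fixes A :: "'m::finite \<Rightarrow> real^'n^'n"
  assumes symmetric: "transpose (A i) = A i"
    and clifford: "A i ** A j + A j ** A i = (if i = j then 2 else 0) *\<^sub>R mat 1"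
begin

definition quad :: "real^'n \<Rightarrow> real^'m"
  where "quad x = (\<chi> i. (A i *v x) \<bullet> x)"

lemma quad_nth: "quad x $ i = (A i *v x) \<bullet> x"
  by (simp add: quad_def)

lemma inner_A: "(A i *v x) \<bullet> y = x \<bullet> (A i *v y)"
  using dot_lmul_matrix[of x "A i" y] vector_transpose_matrix[of x "A i"] transpose_matrix_vector[of "A i" x]
  by (simp add: symmetric)

lemma anticommute: "A i *v (A j *v x) + A j *v (A i *v x) = (if i = j then 2 else 0) *\<^sub>R x"
proof -
  have "(A i ** A j + A j ** A i) *v x = (if i = j then 2 else 0) *\<^sub>R x"
    unfolding clifford by (simp add: scaleR_matrix_vector_assoc[symmetric])
  then show ?thesis by (simp add: matrix_vector_mul_assoc matrix_vector_mult_add_rdistrib)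
qed

lemma involution: "A i *v (A i *v x) = x"
  using anticommute[of i i x] by (simp add: scaleR_2[symmetric])

text \<open>
  This orthogonality is the source of all metric properties of the quadratic map: polarizing the
  Clifford relation with the symmetry of the matrices yields an orthogonal frame of common length
  at every point.
\<close>

lemma inner_A_A: "(A i *v x) \<bullet> (A j *v x) = (if i = j then (norm x)\<^sup>2 else 0)"
proof -
  have "(A i *v x) \<bullet> (A j *v x) + (A j *v x) \<bullet> (A i *v x)
      = x \<bullet> (A i *v (A j *v x) + A j *v (A i *v x))"
    by (simp add: inner_A inner_add_right)
  also have "\<dots> = (if i = j then 2 else 0) * (norm x)\<^sup>2"
    by (simp add: anticommute power2_norm_eq_inner)
  finally show ?thesis by (simp add: inner_commute split: if_splits)
qed

lemma has_derivative_quad_nth: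
  "((\<lambda>x. quad x $ i) has_derivative (\<lambda>h. (2 *\<^sub>R (A i *v x)) \<bullet> h)) (at x)"
proof -
  have "((\<lambda>x. (A i *v x) \<bullet> x) has_derivative (\<lambda>h. (A i *v x) \<bullet> h + (A i *v h) \<bullet> x)) (at x)"
    by (auto intro!: derivative_eq_intros bounded_linear_imp_has_derivative
        simp: linear_conv_bounded_linear[symmetric])
  moreover have "(\<lambda>h. (A i *v x) \<bullet> h + (A i *v h) \<bullet> x) = (\<lambda>h. (2 *\<^sub>R (A i *v x)) \<bullet> h)"
    by (simp add: fun_eq_iff) (metis inner_A inner_commute)
  ultimately show ?thesis by (simp add: quad_def)
qed

lemma grad_quad: "grad (\<lambda>x. quad x $ i) x = 2 *\<^sub>R (A i *v x)"
  by (rule grad_eqI[OF has_derivative_quad_nth])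

lemma grad_quad_inner:
  "grad (\<lambda>x. quad x $ i) x \<bullet> grad (\<lambda>x. quad x $ j) x = (if i = j then 4 * (norm x)\<^sup>2 else 0)"
  by (simp add: grad_quad inner_A_A)

lemma has_derivative_quad:
  "(quad has_derivative (\<lambda>h. \<chi> i. (2 *\<^sub>R (A i *v x)) \<bullet> h)) (at x)"
  unfolding has_derivative_componentwise_within[of quad]
  using has_derivative_quad_nth by (auto simp: Basis_vec_def inner_axis)

lemma homogeneous_quad: "homogeneous_poly 2 (\<lambda>x. quad x $ i)"
proof -
  have "homogeneous_poly (1 + 1) (\<lambda>x::real^'n. \<Sum>j\<in>UNIV. (\<Sum>k\<in>UNIV. A i $ j $ k * x $ k) * x $ j)"
    by (intro homogeneous_poly_sum homogeneous_poly_mult[OF homogeneous_poly_sum]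
        homogeneous_poly_cmult homogeneous_poly_component)
  then show ?thesis
    by (simp only: quad_nth inner_vec_def inner_real_def matrix_vector_mult_def vec_lambda_beta one_add_one)
qed

lemma smooth_quad: "smooth_on quad UNIV"
  unfolding smooth_on_def
  by (intro allI Ck_on_vec_lambda open_UNIV real_polynomial_function_Ck_on
      homogeneous_poly_real_polynomial_function[OF homogeneous_quad])

text \<open>
  With at least two generators each one is conjugate, by another, to its own negative.
\<close>

lemma trace_eq_0:
  assumes "CARD('m) \<ge> 2"
  shows "trace (A i) = 0"
proof -
  have "\<not> CARD('m) \<le> Suc 0" using assms by simp
  then obtain j where "j \<noteq> i"
    using card_le_Suc0_iff_eq[of "UNIV :: 'm set"] by (metis finite)
  have sq: "A j ** A j = mat 1"
    by (simp add: matrix_eq involution flip: matrix_vector_mul_assoc)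
  have "A j ** A i ** A j = - A i"
  proof -
    have "A j *v (A i *v (A j *v x)) = - (A i *v x)" for x
      using anticommute[of i j "A j *v x"] \<open>j \<noteq> i\<close> by (simp add: involution eq_neg_iff_add_eq_0 add.commute)
    moreover have "(- A i) *v x = - (A i *v x)" for x
      by (simp add: matrix_vector_mult_def vec_eq_iff sum_negf)
    ultimately show ?thesis by (simp add: matrix_eq flip: matrix_vector_mul_assoc)
  qed
  then have "trace (A j ** A i ** A j) = - trace (A i)" by (simp add: trace_def sum_negf)
  moreover have "trace (A j ** A i ** A j) = trace (A i)"
    using trace_mul_sym[of "A j ** A i" "A j"] by (simp add: matrix_mul_assoc sq)
  ultimately show ?thesis by simp
qed

lemma laplacian_quad:
  assumes "CARD('m) \<ge> 2"
  shows "laplacian (\<lambda>x. quad x $ i) x = 0"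
proof -
  have 1: "partial k (\<lambda>x. quad x $ i) = (\<lambda>x. 2 * (A i *v x) $ k)" for k
    by (simp add: fun_eq_iff partial_eqI[OF has_derivative_quad_nth] inner_axis)
  have "partial k (\<lambda>x. 2 * (A i *v x) $ k) x = 2 * A i $ k $ k" for k
  proof -
    have "bounded_linear (\<lambda>x. 2 * (A i *v x) $ k)"
      by (intro bounded_linear_const_mult bounded_linear_compose[OF bounded_linear_vec_nth])
        (simp add: linear_conv_bounded_linear[symmetric])
    from partial_eqI[OF bounded_linear_imp_has_derivative[OF this]] show ?thesis
      by (simp add: matrix_vector_mult_def axis_def if_distrib cong: if_cong)
  qed
  then have "laplacian (\<lambda>x. quad x $ i) x = 2 * trace (A i)"
    by (simp add: laplacian_def 1 trace_def sum_distrib_left)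
  then show ?thesis by (simp add: trace_eq_0[OF assms])
qed

text \<open>
  The components of \<open>quad x\<close> are the inner products of \<open>x\<close> with an orthogonal family of vectors of
  length \<open>norm x\<close>, so the bound is Bessel's inequality, here obtained from the Cauchy--Schwarz
  inequality for \<open>x\<close> and the combination of the family with those coefficients.
\<close>

lemma norm_quad_le: "(norm (quad x))\<^sup>2 \<le> ((norm x)\<^sup>2)\<^sup>2"
proof -
  define y where "y = (\<Sum>i\<in>UNIV. quad x $ i *\<^sub>R (A i *v x))"
  have q: "(norm (quad x))\<^sup>2 = (\<Sum>i\<in>UNIV. quad x $ i * quad x $ i)"
    by (simp add: power2_norm_eq_inner inner_vec_def)
  have xy: "y \<bullet> x = (norm (quad x))\<^sup>2"
    by (simp add: y_def q inner_sum_left quad_nth[symmetric])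
  have "y \<bullet> y = (\<Sum>i\<in>UNIV. quad x $ i * quad x $ i) * (norm x)\<^sup>2"
    by (simp add: y_def inner_sum_left inner_sum_right inner_A_A if_distrib sum_distrib_right
        mult.assoc cong: if_cong)
  then have yy: "y \<bullet> y = (norm (quad x))\<^sup>2 * (norm x)\<^sup>2" by (simp add: q)
  have "((norm (quad x))\<^sup>2)\<^sup>2 \<le> ((norm (quad x))\<^sup>2 * (norm x)\<^sup>2) * (norm x)\<^sup>2"
    using Cauchy_Schwarz_ineq[of y x] by (simp add: xy yy power2_norm_eq_inner)
  then have "(norm (quad x))\<^sup>2 * (norm (quad x))\<^sup>2 \<le> (norm (quad x))\<^sup>2 * ((norm x)\<^sup>2)\<^sup>2"
    by (simp add: power2_eq_square mult.assoc)
  then show ?thesis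
    by (cases "quad x = 0") (simp_all only: mult_le_cancel_left_pos zero_less_power2 norm_eq_zero
        norm_zero zero_power2 zero_le_power2 not_False_eq_True)
qed

text \<open>
  For a unit vector \<open>a\<close> in direction \<open>y\<close> the combination \<open>B\<close> of the matrices with coefficients \<open>a\<close>
  is an involution of trace \<open>0\<close>, hence has a nonzero fixed vector. Scaled to \<open>z\<close> with squared norm
  \<open>norm y\<close>, it has \<open>quad z \<bullet> a = norm y\<close>, while \<open>quad z\<close> has norm at most \<open>norm y\<close>;
  this equality case forces \<open>quad z = y\<close>.
\<close>

lemma surj_quad:
  assumes "CARD('m) \<ge> 2"
  shows "surj quad"
proof -
  have "\<exists>x. quad x = y" for y
  proof (cases "y = 0")
    case True
    then show ?thesis by (intro exI[of _ 0]) (simp add: quad_def vec_eq_iff)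
  next
    case False
    define a where "a = y /\<^sub>R norm y"
    have aa: "a \<bullet> a = 1" using False by (simp add: a_def flip: power2_norm_eq_inner)
    define B where "B x = (\<Sum>i\<in>UNIV. a $ i *\<^sub>R (A i *v x))" for x
    have add: "B (x + z) = B x + B z" for x z
      by (simp add: B_def matrix_vector_right_distrib scaleR_right_distrib sum.distrib)
    have scale: "B (t *\<^sub>R x) = t *\<^sub>R B x" for t x
      by (simp add: B_def matrix_vector_mult_scaleR scaleR_sum_right mult.commute)
    have BB: "B (B x) = x" for x
    proof -
      \<comment> \<open>Symmetrizing the double sum brings in the anticommutators.\<close>
      have BB1: "B (B x) = (\<Sum>i\<in>UNIV. \<Sum>j\<in>UNIV. (a $ i * a $ j) *\<^sub>R (A i *v (A j *v x)))"
        by (simp add: B_def linear_sum[OF matrix_vector_mul_linear] matrix_vector_mult_scaleR scaleR_sum_right)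
      have "B (B x) = (\<Sum>i\<in>UNIV. \<Sum>j\<in>UNIV. (a $ i * a $ j) *\<^sub>R (A j *v (A i *v x)))"
        unfolding BB1 by (subst sum.swap) (simp add: mult.commute)
      then have "B (B x) + B (B x) = (\<Sum>i\<in>UNIV. \<Sum>j\<in>UNIV. (a $ i * a $ j) *\<^sub>R (A i *v (A j *v x) + A j *v (A i *v x)))"
        using BB1 by (simp add: scaleR_right_distrib sum.distrib)
      also have "\<dots> = (\<Sum>i\<in>UNIV. (2 * (a $ i * a $ i)) *\<^sub>R x)"
      proof -
        have "(a $ i * a $ j) *\<^sub>R ((if i = j then 2 else 0) *\<^sub>R x) =
            (if i = j then (2 * (a $ i * a $ i)) *\<^sub>R x else 0)" for i j by simp
        then show ?thesis unfolding anticommute by simp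
      qed
      also have "\<dots> = (2 * (a \<bullet> a)) *\<^sub>R x"
        by (simp add: inner_vec_def scaleR_sum_left sum_distrib_left)
      finally show ?thesis by (simp add: aa scaleR_2 flip: scaleR_2)
    qed
    \<comment> \<open>Otherwise \<open>B\<close> is minus the identity, whose trace is not zero.\<close>
    obtain v where v: "B v \<noteq> - v"
    proof (rule ccontr)
      assume "\<not> thesis"
      then have neg: "B v = - v" for v using that by blast
      have "(\<Sum>k\<in>UNIV. B (axis k 1) $ k) = (\<Sum>k\<in>UNIV. \<Sum>i\<in>UNIV. a $ i * A i $ k $ k)"
        by (simp add: B_def matrix_vector_mult_def axis_def if_distrib cong: if_cong)
      also have "\<dots> = (\<Sum>i\<in>UNIV. a $ i * trace (A i))"
        by (subst sum.swap) (simp add: trace_def sum_distrib_left)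
      also have "\<dots> = 0" by (simp add: trace_eq_0[OF assms])
      finally show False by (simp add: neg)
    qed
    define x where "x = v + B v"
    have x0: "x \<noteq> 0" using v by (auto simp: x_def eq_neg_iff_add_eq_0 add.commute)
    have Bx: "B x = x" by (simp add: x_def add BB add.commute)
    define z where "z = (sqrt (norm y) / norm x) *\<^sub>R x"
    have zz: "(norm z)\<^sup>2 = norm y" using x0 by (simp add: z_def)
    have "quad z \<bullet> a = B z \<bullet> z"
      by (simp add: B_def inner_sum_left inner_vec_def[of "quad z"] quad_nth mult.commute)
    also have "B z = z" by (simp add: z_def scale Bx)
    also have "z \<bullet> z = norm y" using zz by (simp add: power2_norm_eq_inner)
    finally have "quad z \<bullet> y = (norm y)\<^sup>2"
      using False by (simp add: a_def power2_eq_square field_simps)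
    moreover have "(norm (quad z))\<^sup>2 \<le> (norm y)\<^sup>2" using norm_quad_le[of z] by (simp add: zz)
    moreover have "(norm (quad z - y))\<^sup>2 = (norm (quad z))\<^sup>2 - 2 * (quad z \<bullet> y) + (norm y)\<^sup>2"
      by (simp add: power2_norm_eq_inner inner_diff_left inner_diff_right inner_commute)
    ultimately have "(norm (quad z - y))\<^sup>2 \<le> 0" by simp
    then show ?thesis by (intro exI[of _ z]) simp
  qed
  then show ?thesis by (metis surjI)
qed

text \<open>
  Near a nonzero zero \<open>p\<close> the vectors \<open>w i\<close>, half the gradients of the components, are orthogonal
  and nonzero. The slice chart keeps the part of \<open>x\<close> orthogonal to their span and replaces its
  inner products with the \<open>w i\<close> by the values \<open>quad x $ i / 2\<close>. The zero set then becomes the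
  orthogonal complement of the \<open>w i\<close>.
\<close>

lemma smooth_submanifold_zero_set: "smooth_submanifold_codim CARD('m) (quad -` {0} - {0})"
  unfolding smooth_submanifold_codim_def
proof
  fix p assume "p \<in> quad -` {0} - {0}"
  then have p: "p \<noteq> 0" by auto
  define w where "w i = A i *v p" for i
  have ww: "w i \<bullet> w j = (if i = j then (norm p)\<^sup>2 else 0)" for i j
    by (simp add: w_def inner_A_A)
  \<comment> \<open>The factor \<open>1 / 2\<close> makes the derivative at \<open>p\<close> the identity.\<close>
  define \<phi> where "\<phi> x = x + (\<Sum>i\<in>UNIV. (inverse ((norm p)\<^sup>2) * ((1/2) * quad x $ i + (- 1) * (x \<bullet> w i))) *\<^sub>R w i)" for x
  define D where "D x h = h + (\<Sum>i\<in>UNIV. (inverse ((norm p)\<^sup>2) * ((1/2) * ((2 *\<^sub>R (A i *v x)) \<bullet> h) + (- 1) * (h \<bullet> w i))) *\<^sub>R w i)" for x h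
  have coord: "\<phi> x \<bullet> w j = quad x $ j / 2" for x j
    using p by (simp add: \<phi>_def inner_add_left inner_sum_left ww if_distrib cong: if_cong)
      (simp add: field_simps)
  have der: "(\<phi> has_derivative D x) (at x)" for x
    unfolding \<phi>_def D_def
    by (intro has_derivative_add has_derivative_sum has_derivative_scaleR_left has_derivative_mult_right
        has_derivative_quad_nth has_derivative_ident has_derivative_inner_left)
  have "Ck_on k \<phi> S" if "open S" for k S
    unfolding \<phi>_def
    by (intro Ck_on_add Ck_on_sum Ck_on_scaleR Ck_on_mult Ck_on_const Ck_on_bounded_linear that
        bounded_linear_ident bounded_linear_inner_left
        Ck_on_subset[OF smooth_on_component[OF smooth_quad]] subset_UNIV)
  then have sm: "smooth_on \<phi> (- {0})" by (simp add: smooth_on_def open_Compl)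
  have "D p = id"
    by (simp add: D_def fun_eq_iff w_def inner_commute)
  then have bij: "bij (frechet_derivative \<phi> (at p))"
    using frechet_derivative_at[OF der[of p]] by simp
  obtain U V where U: "U \<subseteq> - {0}" "p \<in> U" "diffeomorphism_between \<phi> U V"
    using smooth_inverse_function[OF _ sm _ bij] p by (metis open_Compl closed_singleton Compl_iff singletonD)
  define L where "L = {y. \<forall>i. y \<bullet> w i = 0}"
  have "subspace L" by (auto simp: L_def subspace_def inner_add_left)
  have "inj w"
    by (rule injI) (metis ww p norm_eq_zero power_eq_0_iff)
  have "independent (range w)"
    by (rule pairwise_orthogonal_independent)
      (use ww p in \<open>auto simp: pairwise_def orthogonal_def w_def\<close>, metis inner_zero_left norm_eq_zero power_eq_0_iff ww w_def)
  then have "dim (span (range w)) = CARD('m)"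
    by (simp add: dim_eq_card_independent card_image \<open>inj w\<close>)
  moreover have "L = {y \<in> UNIV. \<forall>x\<in>span (range w). orthogonal x y}"
  proof -
    have "(\<forall>x\<in>span (range w). orthogonal x y) \<longleftrightarrow> (\<forall>i. y \<bullet> w i = 0)" for y
    proof
      assume "\<forall>x\<in>span (range w). orthogonal x y"
      then show "\<forall>i. y \<bullet> w i = 0" by (metis inner_commute orthogonal_def rangeI span_base)
    next
      assume y: "\<forall>i. y \<bullet> w i = 0"
      have "orthogonal y v" if "v \<in> span (range w)" for v
        by (rule orthogonal_to_span[OF that]) (use y in \<open>auto simp: orthogonal_def\<close>)
      then show "\<forall>x\<in>span (range w). orthogonal x y" by (simp add: orthogonal_commute)
    qed
    then show ?thesis by (simp add: L_def)
  qed
  ultimately have "dim L + CARD('m) = DIM(real^'n)"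
    using dim_subspace_orthogonal_to_vectors[of "span (range w)" UNIV] by simp
  moreover have "\<phi> ` (U \<inter> (quad -` {0} - {0})) = V \<inter> L"
  proof -
    have "\<phi> ` U = V" using U(3) by (simp add: diffeomorphism_between_def bij_betw_def)
    moreover have "\<phi> x \<in> L \<longleftrightarrow> quad x = 0" for x
      by (simp add: L_def coord vec_eq_iff)
    ultimately show ?thesis using U(1) by auto
  qed
  ultimately show "\<exists>U V \<phi> L. p \<in> U \<and> diffeomorphism_between \<phi> U V \<and>
       subspace L \<and> dim L + CARD('m) = DIM(real^'n) \<and> \<phi> ` (U \<inter> (quad -` {0} - {0})) = V \<inter> L"
    using U \<open>subspace L\<close> by blast
qed

end


section \<open>The Clifford construction\<close>

theorem lemma9p3:
  fixes A :: "'m::finite \<Rightarrow> real^'n^'n"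
    and P :: "real^'n \<Rightarrow> real^'m"
    and R Q lam :: "real^'n \<Rightarrow> real"
    and \<eta> \<kappa> :: real
  assumes m_ge_2: "CARD('m) \<ge> 2"
    and symmetric: "\<And>i. transpose (A i) = A i"
    and clifford: "\<And>i j. A i ** A j + A j ** A i = (if i = j then 2 else 0) *\<^sub>R mat 1"
  defines "P \<equiv> \<lambda>x. \<chi> i. (A i *v x) \<bullet> x"
    and "R \<equiv> \<lambda>x. (norm x)\<^sup>2"
    and "Q \<equiv> \<lambda>x. (norm (P x))\<^sup>2"
    and "lam \<equiv> \<lambda>x. sqrt (4 * R x)"
    and "\<eta> \<equiv> 16"
    and "\<kappa> \<equiv> 1 / 2"
  shows "(\<forall>\<A>. laplacian_algebra \<A> \<longrightarrow>
            laplacian_algebra (generated_algebra (insert R (pullback P \<A>)))) \<and>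
         surj P \<and>
         (\<forall>x. Q x \<le> (R x)\<^sup>2) \<and>
         (P -` {0} - {0} \<noteq> {} \<longrightarrow> smooth_submanifold_codim CARD('m) (P -` {0} - {0})) \<and>
         (\<forall>i. homogeneous_poly 2 (\<lambda>x. P x $ i)) \<and>
         harmonic_morphism P \<and>
         has_squared_dilation P (\<lambda>x. (lam x)\<^sup>2) \<and>
         (\<forall>x. (lam x)\<^sup>2 = 4 * R x) \<and>
         (\<forall>i x. laplacian (\<lambda>x. P x $ i) x = 0) \<and>
         (\<forall>i j x. grad (\<lambda>x. P x $ i) x \<bullet> grad (\<lambda>x. P x $ j) x = 4 * R x * (if i = j then 1 else 0)) \<and>
         (\<forall>x. frechet_derivative P (at x) (grad (\<lambda>x. (lam x)\<^sup>2) x) = \<eta> *\<^sub>R P x) \<and>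
         (\<forall>x. x \<noteq> 0 \<longrightarrow> (norm (P x))\<^sup>2 * \<eta> / (2 * (lam x) ^ 4) \<le> \<kappa>)"
proof -
  interpret clifford_system A
    using symmetric clifford by unfold_locales
  have P: "P = quad" by (simp add: P_def quad_def fun_eq_iff)
  have lam: "(lam x)\<^sup>2 = 4 * R x" for x by (simp add: lam_def R_def)
  have R: "R = (\<lambda>x. (norm x)\<^sup>2)" by (simp add: R_def)
  have dil: "has_squared_dilation quad (\<lambda>x. 4 * (norm x)\<^sup>2)"
    unfolding has_squared_dilation_def using grad_quad_inner by blast
  have 1: "frechet_derivative quad (at x) (grad (\<lambda>x. 4 * (norm x)\<^sup>2) x) = 16 *\<^sub>R quad x" for x
  proof -
    have "((\<lambda>x. 4 * (norm x)\<^sup>2) has_derivative (\<lambda>v. 4 * ((2 *\<^sub>R x) \<bullet> v))) (at x)"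
      by (intro has_derivative_mult_right has_derivative_norm_squared)
    then have "grad (\<lambda>x. 4 * (norm x)\<^sup>2) x = 8 *\<^sub>R x"
      by (intro grad_eqI) simp
    then show ?thesis
      by (simp only: frechet_derivative_at[OF has_derivative_quad, symmetric])
        (simp add: vec_eq_iff quad_nth)
  qed
  have 2: "(norm (quad x))\<^sup>2 * 16 / (2 * (lam x) ^ 4) \<le> 1 / 2" if "x \<noteq> 0" for x
  proof -
    have "(lam x) ^ 4 = 16 * ((norm x)\<^sup>2)\<^sup>2"
      using power_mult[of "lam x" 2 2] by (simp add: lam R power_mult_distrib)
    then show ?thesis using norm_quad_le[of x] that by (simp add: field_simps)
  qed
  show ?thesis
    unfolding P lam R Q_def \<eta>_def \<kappa>_def
    using laplacian_algebra_generated_pullback[OF _ homogeneous_quad dil laplacian_quad[OF m_ge_2]]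
      surj_quad[OF m_ge_2] norm_quad_le smooth_submanifold_zero_set homogeneous_quad
      harmonic_morphism_dilation[OF dil smooth_quad laplacian_quad[OF m_ge_2]] dil
      laplacian_quad[OF m_ge_2] 1 2 grad_quad_inner lam
    by (auto simp: R)
qed

end
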